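(* Let $h\ge 1$ and let $m_i\ge 3$ be integers for $1\le i\le h-1$. Set $T^z=T^z_{2,m_1,\ldots,m_{h-1}}$ for $z=1,2$. Then $$\mathrm{rn}(T^z)=\begin{cases}\displaystyle\sum_{i=1}^{h-1}\bigl(4(h-i)-2\bigr)\Bigl(\prod_{j=1}^{i}(m_j-1)\Bigr)+\prod_{i=1}^{h-1}(m_i-1)+4h-1, & \text{if } z=1,\\[2ex] \displaystyle\sum_{i=1}^{h-1}\bigl(4(h-i)-2\bigr)\Bigl(\prod_{j=1}^{i}(m_j-1)\Bigr)+2\prod_{i=1}^{h-1}(m_i-1)+6h-3, & \text{if } z=2.\end{cases}$$
   Context: A radio labelling of a graph $G$ is a map $f: V(G)\to\{0,1,2,\ldots\}$ with $|f(u)-f(v)| \ge \mathrm{diam}(G)+1-d(u,v)$ for all distinct $u,v\in V(G)$. Its span is $\max\{|f(u)-f(v)|: u,v\in V(G)\}$, and the radio number $\mathrm{rn}(G)$ is the minimum span of a radio labelling of $G$. The center $L_0$ of a tree $T$ is the set of vertices of minimum eccentricity; it is one vertex or two adjacent vertices according as $\mathrm{diam}(T)$ is even or odd. The height is $h=\lfloor\mathrm{diam}(T)/2\rfloor$, and $L_i$ is the set of vertices at distance $i$ from $L_0$ (minimum distance to a vertex of $L_0$), $0\le i\le h$. $T$ is level-wise regular if for each $0\le i\le h$ all vertices in $L_i$ have the same degree $m_i$ (so $m_h=1$ and all leaves are in $L_h$). Up to isomorphism such a tree is determined by $(m_0,\ldots,m_{h-1})$ and $z=|L_0|\in\{1,2\}$,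 and is denoted $T^z_{m_0,m_1,\ldots,m_{h-1}}$. Its diameter is $2h$ if $z=1$ and $2h+1$ if $z=2$.
   Formalization: The case z=1, h=1 is excluded: there the tree is the path on three vertices, whose radio number is 3 (labels 0, 3, 1 along the path), while the printed formula gives 4; so for z=1 it is assumed that h≥2. *)

theory Defs
  imports Graph_Theory.Graph_Theory
begin

text \<open>
  Finite simple undirected graphs are the symmetric digraphs of the locale \<^const>\<open>graph\<close>, each
  edge being a pair of opposite arcs. Hence \<open>out_degree\<close> is the ordinary vertex degree. The
  constant \<open>tree\<close> of the library is unsuitable here: it counts the walk \<open>a, b, a\<close>
  as a cycle, so an undirected cycle is required to have length at least 3.
\<close>

definition undirected_tree :: "('a, 'b) pre_digraph \<Rightarrow> bool" where
  "undirected_tree G \<longleftrightarrow>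
     graph G \<and> connected G \<and> \<not> (\<exists>p. pre_digraph.cycle G p \<and> 3 \<le> length p)"

definition gdist :: "('a, 'b) pre_digraph \<Rightarrow> 'a \<Rightarrow> 'a \<Rightarrow> nat" where
  "gdist G u v = (LEAST n. \<exists>p. pre_digraph.awalk G u p v \<and> length p = n)"

definition diameter :: "('a, 'b) pre_digraph \<Rightarrow> nat" where
  "diameter G = Max {gdist G u v | u v. u \<in> verts G \<and> v \<in> verts G}"

definition eccentricity :: "('a, 'b) pre_digraph \<Rightarrow> 'a \<Rightarrow> nat" where
  "eccentricity G v = Max {gdist G v u | u. u \<in> verts G}"

definition center :: "('a, 'b) pre_digraph \<Rightarrow> 'a set" where
  "center G = {v \<in> verts G. \<forall>u \<in> verts G. eccentricity G v \<le> eccentricity G u}"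

definition height :: "('a, 'b) pre_digraph \<Rightarrow> nat" where
  "height G = diameter G div 2"

definition level :: "('a, 'b) pre_digraph \<Rightarrow> nat \<Rightarrow> 'a set" where
  "level G i = {v \<in> verts G. Min {gdist G w v | w. w \<in> center G} = i}"

definition level_wise_regular :: "('a, 'b) pre_digraph \<Rightarrow> bool" where
  "level_wise_regular G \<longleftrightarrow> undirected_tree G \<and>
     (\<forall>i \<le> height G. \<exists>d. \<forall>v \<in> level G i. out_degree G v = d)"

text \<open>
  \<open>is_lwr_tree T z h m\<close> says that \<open>T\<close> is (a copy of) the tree \<open>T\<^sup>z\<close> with degree sequence
  \<open>m 0, ..., m (h - 1)\<close>; the values \<open>m i\<close> for \<open>i \<ge> h\<close> are irrelevant.
\<close>

definition is_lwr_tree :: "('a, 'b) pre_digraph \<Rightarrow> nat \<Rightarrow> nat \<Rightarrow> (nat \<Rightarrow> nat) \<Rightarrow> bool" where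
  "is_lwr_tree T z h m \<longleftrightarrow> level_wise_regular T \<and> card (center T) = z \<and> height T = h \<and>
     (\<forall>i < h. \<forall>v \<in> level T i. out_degree T v = m i)"

definition radio_labelling :: "('a, 'b) pre_digraph \<Rightarrow> ('a \<Rightarrow> nat) \<Rightarrow> bool" where
  "radio_labelling G f \<longleftrightarrow> (\<forall>u \<in> verts G. \<forall>v \<in> verts G. u \<noteq> v \<longrightarrow>
     \<bar>int (f u) - int (f v)\<bar> \<ge> int (diameter G) + 1 - int (gdist G u v))"

definition radio_span :: "('a, 'b) pre_digraph \<Rightarrow> ('a \<Rightarrow> nat) \<Rightarrow> nat" where
  "radio_span G f = Max {nat \<bar>int (f u) - int (f v)\<bar> | u v. u \<in> verts G \<and> v \<in> verts G}"

definition radio_number :: "('a, 'b) pre_digraph \<Rightarrow> nat" where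
  "radio_number G = (LEAST k. \<exists>f. radio_labelling G f \<and> radio_span G f = k)"


text \<open>
  The case \<open>z = 1\<close>, \<open>h = 1\<close> is the path with three vertices, whose radio number is 3,
  whereas the formula for \<open>z = 1\<close> evaluates to 4 at \<open>h = 1\<close>. This is why the theorem asks for
  \<open>h \<ge> 2\<close> when \<open>z = 1\<close>.
\<close>

definition path3 :: "(nat, nat \<times> nat) pre_digraph" where
  "path3 = with_proj \<lparr> pverts = {0, 1, 2}, parcs = {(0, 1), (1, 0), (1, 2), (2, 1)} \<rparr>"

lemma path3_simps:
  "verts path3 = {0, 1, 2}" "arcs path3 = {(0, 1), (1, 0), (1, 2), (2, 1)}"
  "tail path3 = fst" "head path3 = snd"
  by (simp_all add: path3_def)

lemma path3_awalk:
  "pre_digraph.awalk path3 u p v \<longleftrightarrow> u \<in> {0, 1, 2} \<and> set p \<subseteq> arcs path3 \<and> pcas u p v"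
  by (simp add: path3_def pre_digraph.awalk_def cas_with_proj_eq)

lemma path3_gdist:
  assumes "u \<in> {0, 1, 2}" "v \<in> {0, 1, 2}"
  shows "gdist path3 u v = nat \<bar>int u - int v\<bar>"
proof -
  have lower: "nat \<bar>int u - int v\<bar> \<le> length p" if "set p \<subseteq> arcs path3" "pcas u p v" for u v p
    using that
  proof (induction p arbitrary: u)
    case (Cons e p)
    then have "nat \<bar>int (snd e) - int v\<bar> \<le> length p" by auto
    moreover have "\<bar>int u - int (snd e)\<bar> \<le> 1" using Cons.prems by (auto simp: path3_simps)
    ultimately show ?case by simp
  qed simp
  have "\<exists>p. pre_digraph.awalk path3 u p v \<and> length p = nat \<bar>int u - int v\<bar>"
  proof -
    consider "u = v" | "\<bar>int u - int v\<bar> = 1" | "u = 0" "v = 2" | "u = 2" "v = 0"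
      using assms by auto
    then show ?thesis
    proof cases
      case 1
      then show ?thesis using assms by (intro exI[of _ "[]"]) (auto simp: path3_awalk)
    next
      case 2
      then show ?thesis using assms
        by (intro exI[of _ "[(u, v)]"]) (auto simp: path3_awalk path3_simps)
    next
      case 3
      then show ?thesis
        by (intro exI[of _ "[(0, 1), (1, 2)]"]) (auto simp: path3_awalk path3_simps)
    next
      case 4
      then show ?thesis
        by (intro exI[of _ "[(2, 1), (1, 0)]"]) (auto simp: path3_awalk path3_simps)
    qed
  qed
  then show ?thesis
    unfolding gdist_def by (intro Least_equality) (auto simp: path3_awalk intro: lower)
qed

lemma path3_eccentricity:
  "eccentricity path3 0 = 2" "eccentricity path3 1 = 1" "eccentricity path3 2 = 2"
proof -
  have *: "{gdist path3 v u | u. u \<in> verts path3} = gdist path3 v ` {0, 1, 2}" for v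
    by (auto simp: path3_simps)
  show "eccentricity path3 0 = 2" "eccentricity path3 1 = 1" "eccentricity path3 2 = 2"
    unfolding eccentricity_def * by (simp_all add: path3_gdist)
qed

lemma path3_center: "center path3 = {1}"
  using path3_eccentricity by (auto simp: center_def path3_simps)

lemma path3_diameter: "diameter path3 = 2"
proof -
  have "{gdist path3 u v | u v. u \<in> verts path3 \<and> v \<in> verts path3}
      = (\<lambda>(u, v). gdist path3 u v) ` ({0, 1, 2} \<times> {0, 1, 2})"
    by (auto simp: path3_simps)
  also have "\<dots> = {0, 1, 2}"
    by (auto simp: path3_gdist Sigma_def image_iff)
  finally show ?thesis by (simp add: diameter_def)
qed

lemma path3_level:
  "level path3 0 = {1}" "level path3 1 = {0, 2}"
  unfolding level_def path3_center by (auto simp: path3_simps path3_gdist)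

lemma path3_undirected_tree: "undirected_tree path3"
proof -
  have g: "graph path3"
  proof -
    have "pair_graph \<lparr> pverts = {0, 1, 2::nat}, parcs = {(0, 1), (1, 0), (1, 2), (2, 1)} \<rparr>"
      by unfold_locales (auto simp: symmetric_def sym_def)
    then interpret pair_graph "\<lparr> pverts = {0, 1, 2::nat}, parcs = {(0, 1), (1, 0), (1, 2), (2, 1)} \<rparr>" .
    show ?thesis unfolding path3_def by unfold_locales
  qed
  interpret graph path3 by (rule g)
  have walk: "\<exists>p. awalk u p v" if uv: "u \<in> {0, 1, 2}" "v \<in> {0, 1, 2}" for u v
  proof -
    consider "u = v" | "\<bar>int u - int v\<bar> = 1" | "u = 0" "v = 2" | "u = 2" "v = 0"
      using uv by auto
    then show ?thesis
    proof cases
      case 1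
      then show ?thesis using uv by (intro exI[of _ "[]"]) (auto simp: path3_awalk)
    next
      case 2
      then show ?thesis using uv
        by (intro exI[of _ "[(u, v)]"]) (auto simp: path3_awalk path3_simps)
    next
      case 3
      then show ?thesis
        by (intro exI[of _ "[(0, 1), (1, 2)]"]) (auto simp: path3_awalk path3_simps)
    next
      case 4
      then show ?thesis
        by (intro exI[of _ "[(2, 1), (1, 0)]"]) (auto simp: path3_awalk path3_simps)
    qed
  qed
  have reach: "u \<rightarrow>\<^sup>*\<^bsub>path3\<^esub> v" if "u \<in> verts path3" "v \<in> verts path3" for u v
    using walk[OF that[unfolded path3_simps]] by (simp only: reachable_awalk)
  have "strongly_connected path3"
    by (rule strongly_connectedI) (simp add: path3_simps(1), rule reach)
  moreover have "with_proj (mk_symmetric path3) = path3"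
  proof -
    have "(\<Union>e\<in>arcs path3. {(fst e, snd e), (snd e, fst e)}) = arcs path3"
      unfolding path3_simps by auto
    then show ?thesis
      by (simp add: with_proj_def mk_symmetric_def path3_simps)
  qed
  ultimately have "connected path3" by (simp only: connected_def)
  moreover have "\<not> (\<exists>p. cycle p \<and> 3 \<le> length p)"
  proof
    assume "\<exists>p. cycle p \<and> 3 \<le> length p"
    then obtain p u where p: "awalk u p u" "distinct (tl (awalk_verts u p))" "3 \<le> length p"
      by (auto simp: cycle_def)
    have "set (awalk_verts u p) \<subseteq> {0, 1, 2}"
      using p(1) unfolding awalk_conv path3_simps(1) by simp
    then have "set (tl (awalk_verts u p)) \<subseteq> {0, 1, 2}"
      by (cases "awalk_verts u p") simp_all
    from card_mono[OF _ this] have "card (set (tl (awalk_verts u p))) \<le> 3" by simp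
    then have "length p = 3"
      using p(3) unfolding distinct_card[OF p(2)] by (simp add: length_awalk_verts)
    then obtain a b c where "p = [a, b, c]"
      unfolding numeral_3_eq_3 length_Suc_conv by blast
    then show False using p(1) by (auto simp: path3_awalk path3_simps)
  qed
  ultimately show ?thesis using g by (simp add: undirected_tree_def)
qed

lemma path3_is_lwr_tree: "is_lwr_tree path3 1 1 (\<lambda>i. 2)"
proof -
  have "out_arcs path3 0 = {(0, 1)}" "out_arcs path3 1 = {(1, 0), (1, 2)}"
    "out_arcs path3 2 = {(2, 1)}"
    by (auto simp: out_arcs_def path3_simps)
  then have deg: "out_degree path3 0 = 1" "out_degree path3 1 = 2" "out_degree path3 2 = 1"
    by (simp_all add: out_degree_def)
  have "level_wise_regular path3"
    unfolding level_wise_regular_def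
    using path3_undirected_tree path3_level deg
    by (auto simp: height_def path3_diameter le_Suc_eq)
  then show ?thesis
    using path3_level deg by (simp add: is_lwr_tree_def path3_center height_def path3_diameter)
qed

lemma path3_radio_number: "radio_number path3 = 3"
proof -
  have pairs: "{g u v | u v. u \<in> A \<and> v \<in> A} = (\<lambda>(u, v). g u v) ` (A \<times> A)"
    for g :: "nat \<Rightarrow> nat \<Rightarrow> nat" and A by auto
  have span_eq: "radio_span path3 f =
      Max ((\<lambda>(u, v). nat \<bar>int (f u) - int (f v)\<bar>) ` ({0, 1, 2} \<times> {0, 1, 2}))" for f
    unfolding radio_span_def path3_simps pairs ..
  have lab: "radio_labelling path3 f \<longleftrightarrow>
      \<bar>int (f 0) - int (f 1)\<bar> \<ge> 2 \<and> \<bar>int (f 1) - int (f 2)\<bar> \<ge> 2 \<and> \<bar>int (f 0) - int (f 2)\<bar> \<ge> 1" for f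
    by (auto simp: radio_labelling_def path3_simps path3_diameter path3_gdist)
  define f :: "nat \<Rightarrow> nat" where "f = (\<lambda>v. if v = 0 then 0 else if v = 1 then 3 else 1)"
  have "(\<lambda>(u, v). nat \<bar>int (f u) - int (f v)\<bar>) ` ({0, 1, 2} \<times> {0, 1, 2}) = {0, 1, 2, 3}"
    by (auto simp: f_def Sigma_def image_iff)
  then have "radio_span path3 f = 3" by (simp add: span_eq)
  moreover have "radio_labelling path3 f" by (simp add: lab f_def)
  moreover have "3 \<le> radio_span path3 g" if "radio_labelling path3 g" for g
  proof -
    have le: "nat \<bar>int (g u) - int (g v)\<bar> \<le> radio_span path3 g"
      if "u \<in> {0, 1, 2}" "v \<in> {0, 1, 2}" for u v
      unfolding span_eq using that by (intro Max_ge) auto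
    show ?thesis
      using that le[of 0 1] le[of 1 2] le[of 0 2] unfolding lab by auto
  qed
  ultimately show ?thesis
    unfolding radio_number_def by (intro Least_equality) auto
qed

end

theory Submission
  imports Defs
begin

text \<open>
  Write \<open>l v\<close> for the distance from \<open>v\<close> to the center and list the vertices as \<open>u 0, ..., u N\<close>
  by increasing label. Consecutive labels differ by at least \<open>2h + 1 - l (u i) - l (u (i + 1))\<close>;
  call the excess over this the slack \<open>g i \<ge> 0\<close>. The span telescopes to a constant of the tree plus
  \<open>l (u 0) + l (u N)\<close> plus the total slack. As \<open>m 0 = 2\<close>, removing the center leaves only two
  branches, so the two neighbours of a vertex \<open>u i\<close> of level \<open>h\<close> in the list, unless one of them
  is central, either lie in a common branch or one of them lies in the branch of \<open>u i\<close>; in both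
  cases \<open>g (i - 1) + g i \<ge> z\<close>. Counting the vertices of level \<open>h\<close> gives the lower bound. It is
  attained by alternating between the branches and letting these vertices share the slack in
  pairs, provided that vertices close in the list have their common ancestor close to the center;
  such an order of a branch comes from recursively interleaving the subtrees of the children.
\<close>

section \<open>Trees through their distance function\<close>

text \<open>All that the argument uses of a tree, in terms of distances alone. \<open>d_step\<close>
  makes \<open>d\<close> the path metric of the graph with edges \<open>d x y = 1\<close>;
  \<open>acyc\<close> is acyclicity: distinct neighbours of \<open>c\<close> are never joined by a
  walk avoiding \<open>c\<close>.\<close>

locale tree_metric =
  fixes V :: "'a set" and d :: "'a \<Rightarrow> 'a \<Rightarrow> nat"
  assumes fin: "finite V"
    and ne: "V \<noteq> {}"
    and d_eq_0: "\<And>x y. x \<in> V \<Longrightarrow> y \<in> V \<Longrightarrow> d x y = 0 \<longleftrightarrow> x = y"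
    and d_sym: "\<And>x y. x \<in> V \<Longrightarrow> y \<in> V \<Longrightarrow> d x y = d y x"
    and d_tri: "\<And>x y c. x \<in> V \<Longrightarrow> y \<in> V \<Longrightarrow> c \<in> V \<Longrightarrow> d x y \<le> d x c + d c y"
    and d_step: "\<And>x y n. x \<in> V \<Longrightarrow> y \<in> V \<Longrightarrow> d x y = Suc n \<Longrightarrow> \<exists>w\<in>V. d x w = 1 \<and> d w y = n"
    and acyc: "\<And>c a b. c \<in> V \<Longrightarrow> a \<in> V \<Longrightarrow> b \<in> V \<Longrightarrow> d c a = 1 \<Longrightarrow> d c b = 1 \<Longrightarrow> a \<noteq> b \<Longrightarrow>
      (a, b) \<notin> {(x, y). x \<in> V - {c} \<and> y \<in> V - {c} \<and> d x y = 1}\<^sup>*"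
begin

text \<open>Lying in one component once \<open>c\<close> is deleted; the closure also contains
  \<open>(x, x)\<close> for every \<open>x\<close>.\<close>

definition avoid :: "'a \<Rightarrow> ('a \<times> 'a) set" where
  "avoid c = {(x, y). x \<in> V - {c} \<and> y \<in> V - {c} \<and> d x y = 1}\<^sup>*"

lemma acyclic:
  assumes "c \<in> V" "a \<in> V" "b \<in> V" "d c a = 1" "d c b = 1" "(a, b) \<in> avoid c"
  shows "a = b"
  using acyc[OF assms(1-5)] assms(6) unfolding avoid_def by blast

lemma avoid_trans: "(x, y) \<in> avoid c \<Longrightarrow> (y, w) \<in> avoid c \<Longrightarrow> (x, w) \<in> avoid c"
  unfolding avoid_def by (rule rtrancl_trans)

lemma avoid_sym: "(x, y) \<in> avoid c \<Longrightarrow> (y, x) \<in> avoid c"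
proof -
  have "sym {(x, y). x \<in> V - {c} \<and> y \<in> V - {c} \<and> d x y = 1}"
    using d_sym by (auto simp: sym_def)
  then show "(x, y) \<in> avoid c \<Longrightarrow> (y, x) \<in> avoid c"
    unfolding avoid_def using sym_rtrancl[of "{(x, y). x \<in> V - {c} \<and> y \<in> V - {c} \<and> d x y = 1}"]
    by (meson symD)
qed

lemma d_self [simp]: "x \<in> V \<Longrightarrow> d x x = 0"
  using d_eq_0 by blast

text \<open>A shortest path through \<open>c\<close> would have length \<open>d x c + d c y\<close>.
  The strict inequality passes on to the next vertex of a shortest path, so none of its vertices is
  \<open>c\<close>.\<close>

lemma avoid_short:
  assumes "x \<in> V" "y \<in> V" "c \<in> V" "d x y < d x c + d c y"
  shows "(x, y) \<in> avoid c"
  using assms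
proof (induction "d x y" arbitrary: x)
  case 0
  then show ?case using d_eq_0 by (auto simp: avoid_def)
next
  case (Suc n)
  obtain w where w: "w \<in> V" "d x w = 1" "d w y = n"
    using d_step[OF Suc.prems(1,2)] Suc.hyps(2) by metis
  have "d x c \<le> d x w + d w c" using d_tri Suc.prems w by blast
  then have "d w y < d w c + d c y" using Suc.prems w Suc.hyps(2) by linarith
  then have IH: "(w, y) \<in> avoid c" using Suc w by blast
  have "x \<noteq> c" using Suc.prems by auto
  moreover have "w \<noteq> c" using \<open>d w y < d w c + d c y\<close> Suc.prems by auto
  ultimately have "(x, w) \<in> avoid c" using w Suc.prems unfolding avoid_def by auto
  then show ?case using IH avoid_trans by blast
qed

text \<open>The last two hypotheses keep shortest paths from \<open>a\<close> to \<open>x\<close>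
  and from \<open>b\<close> to \<open>y\<close> away from \<open>c\<close>. If one from
  \<open>x\<close> to \<open>y\<close> avoided \<open>c\<close> as well, then \<open>a\<close> and
  \<open>b\<close> would be joined outside \<open>c\<close>.\<close>

lemma branch:
  assumes "c \<in> V" "a \<in> V" "b \<in> V" "d c a = 1" "d c b = 1" "a \<noteq> b"
    and "x \<in> V" "y \<in> V" "d a x \<le> d c x" "d b y \<le> d c y"
  shows "d x y \<ge> d x c + d c y"
proof (rule ccontr)
  assume "\<not> ?thesis"
  then have "(x, y) \<in> avoid c" using avoid_short assms by auto
  moreover have "(a, x) \<in> avoid c" "(b, y) \<in> avoid c"
    using avoid_short[of a x c] avoid_short[of b y c] assms d_sym[of a c] d_sym[of b c] by auto
  ultimately have "(a, b) \<in> avoid c" using avoid_trans avoid_sym by blast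
  then show False using acyclic assms by blast
qed

text \<open>Trees are bipartite. With equal distances, \<open>b\<close> and the neighbour of
  \<open>a\<close> on the way to \<open>u\<close> would both be joined to \<open>u\<close> outside
  \<open>a\<close>, hence coincide; but that neighbour is nearer to \<open>u\<close>.\<close>

lemma adjacent_dist_neq:
  assumes "u \<in> V" "a \<in> V" "b \<in> V" "d a b = 1"
  shows "d u a \<noteq> d u b"
proof
  assume eq: "d u a = d u b"
  show False
  proof (cases "d a u")
    case 0
    then show False using eq assms d_eq_0 d_sym by (metis zero_neq_one)
  next
    case (Suc n)
    obtain w where w: "w \<in> V" "d a w = 1" "d w u = n" using d_step[OF assms(2,1) Suc] by blast
    have eq': "d b u = Suc n" "d b a = 1" "d w a = 1" using eq Suc assms w d_sym by metis+
    have "(w, u) \<in> avoid a" using avoid_short[of w u a] w assms Suc eq' by auto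
    moreover have "(b, u) \<in> avoid a" using avoid_short[of b u a] assms Suc eq' by auto
    ultimately have "w = b" using acyclic[of a w b] w assms avoid_trans avoid_sym by blast
    then show False using w eq' by simp
  qed
qed

lemma geodesic_point:
  assumes "x \<in> V" "y \<in> V" "d x y = i + j"
  shows "\<exists>c\<in>V. d x c = i \<and> d c y = j"
  using assms
proof (induction i arbitrary: x)
  case 0
  then show ?case by (intro bexI[of _ x]) auto
next
  case (Suc i)
  obtain w where w: "w \<in> V" "d x w = 1" "d w y = i + j"
    using d_step[OF Suc.prems(1,2)] Suc.prems(3) by auto
  obtain c where c: "c \<in> V" "d w c = i" "d c y = j" using Suc.IH w Suc.prems by blast
  have "d x c \<le> 1 + i" using d_tri[of x c w] w c Suc.prems by simp
  moreover have "Suc i + j \<le> d x c + j" using d_tri[of x y c] c Suc.prems by simp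
  ultimately show ?case using c by force
qed

text \<open>If \<open>c\<close> differs from \<open>x\<close> and \<open>y\<close>, deleting it puts
  them into different components, and \<open>u\<close> cannot be joined to both outside
  \<open>c\<close>.\<close>

lemma geodesic_separates:
  assumes "x \<in> V" "y \<in> V" "c \<in> V" "u \<in> V" "d x y = d x c + d c y"
  shows "d u x = d u c + d c x \<or> d u y = d u c + d c y"
proof (cases "x = c \<or> y = c")
  case True
  then show ?thesis using assms d_eq_0 by auto
next
  case False
  obtain n k where nk: "d c x = Suc n" "d c y = Suc k"
    using False assms d_eq_0 by (metis not0_implies_Suc)
  obtain x' where x': "x' \<in> V" "d c x' = 1" "d x' x = n" using d_step nk assms by blast
  obtain y' where y': "y' \<in> V" "d c y' = 1" "d y' y = k" using d_step nk assms by blast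
  have s: "d x c = Suc n" "d x x' = n" "d x' c = 1" "d y' c = 1" using nk x' y' assms d_sym by metis+
  have neq: "x' \<noteq> y'"
  proof
    assume "x' = y'"
    then have "d x y \<le> n + k" using d_tri[of x y x'] x' y' assms s by simp
    then show False using assms nk s by simp
  qed
  have av: "(x', x) \<in> avoid c" "(y', y) \<in> avoid c"
    using avoid_short[of x' x c] avoid_short[of y' y c] x' y' assms nk s by auto
  show ?thesis
  proof (rule ccontr)
    assume *: "\<not> ?thesis"
    have "d u x \<le> d u c + d c x" "d u y \<le> d u c + d c y" using d_tri assms by blast+
    then have "(u, x) \<in> avoid c" "(u, y) \<in> avoid c" using * avoid_short assms by auto
    then have "(x', y') \<in> avoid c" using av avoid_trans avoid_sym by blast
    then show False using acyclic x' y' neq assms by blast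
  qed
qed

section \<open>Diameter, eccentricity and center\<close>

definition diam :: nat where "diam = Max {d u v | u v. u \<in> V \<and> v \<in> V}"
definition ecc :: "'a \<Rightarrow> nat" where "ecc v = Max {d v u | u. u \<in> V}"
definition centre :: "'a set" where "centre = {v \<in> V. \<forall>u\<in>V. ecc v \<le> ecc u}"

lemma dists_finite: "finite {d u v | u v. u \<in> V \<and> v \<in> V}" "finite {d v u | u. u \<in> V}"
proof -
  have "{d u v | u v. u \<in> V \<and> v \<in> V} = (\<lambda>(u, v). d u v) ` (V \<times> V)" by auto
  then show "finite {d u v | u v. u \<in> V \<and> v \<in> V}" using fin by simp
  show "finite {d v u | u. u \<in> V}" using fin by simp
qed

lemma d_le_diam: "u \<in> V \<Longrightarrow> v \<in> V \<Longrightarrow> d u v \<le> diam"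
  unfolding diam_def by (rule Max_ge[OF dists_finite(1)]) blast

lemma d_le_ecc: "u \<in> V \<Longrightarrow> d v u \<le> ecc v"
  unfolding ecc_def by (rule Max_ge[OF dists_finite(2)]) blast

lemma ecc_le: "(\<And>u. u \<in> V \<Longrightarrow> d v u \<le> k) \<Longrightarrow> ecc v \<le> k"
  unfolding ecc_def using dists_finite(2) ne by (subst Max_le_iff) auto

lemma diam_attained: "\<exists>x\<in>V. \<exists>y\<in>V. d x y = diam"
proof -
  have "diam \<in> {d u v | u v. u \<in> V \<and> v \<in> V}"
    unfolding diam_def using dists_finite(1) ne by (intro Max_in) auto
  then obtain u v where "diam = d u v" "u \<in> V" "v \<in> V" by blast
  then show ?thesis by metis
qed

text \<open>Every \<open>u\<close> has \<open>x\<close> or \<open>y\<close> beyond \<open>c\<close>,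
  and the path to it through \<open>c\<close> is no longer than
  \<open>d x c + d c y\<close>.\<close>

lemma ecc_midpoint:
  assumes "x \<in> V" "y \<in> V" "c \<in> V" "d x y = diam" "d x y = d x c + d c y"
  shows "ecc c \<le> max (d x c) (d c y)"
proof (rule ecc_le)
  fix u assume u: "u \<in> V"
  have "d u x \<le> diam" "d u y \<le> diam" using d_le_diam assms u by blast+
  moreover have "d u c = d c u" "d c x = d x c" using d_sym u assms by blast+
  ultimately show "d c u \<le> max (d x c) (d c y)"
    using geodesic_separates[OF assms(1-3) u assms(5)] assms by linarith
qed

lemma diam_le_ecc:
  assumes "x \<in> V" "y \<in> V" "u \<in> V" "d x y = diam"
  shows "diam \<le> 2 * ecc u"
  using d_tri[of x y u] d_le_ecc[of x u] d_le_ecc[of y u] d_sym[of x u] assms by linarith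

text \<open>The middle \<open>c\<close> of a longest path has eccentricity half the diameter, and no
  eccentricity is smaller. For any vertex attaining it, one end of the path lies beyond
  \<open>c\<close> and uses up the whole bound, so its distance to \<open>c\<close> is 0.\<close>

lemma centre_even:
  assumes "even diam"
  shows "\<exists>c\<in>V. centre = {c} \<and> (\<forall>v\<in>V. d c v \<le> diam div 2)"
proof -
  obtain x y where xy: "x \<in> V" "y \<in> V" "d x y = diam" using diam_attained by blast
  define k where "k = diam div 2"
  have k: "diam = k + k" using assms unfolding k_def by auto
  obtain c where c: "c \<in> V" "d x c = k" "d c y = k" using geodesic_point xy k by metis
  have ecc_c: "ecc c \<le> k" using ecc_midpoint[of x y c] xy c k by simp
  have low: "k \<le> ecc u" if "u \<in> V" for u using diam_le_ecc[of x y u] that xy k by linarith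
  have uniq: "u = c" if u: "u \<in> V" "ecc u \<le> k" for u
  proof -
    have "d u x \<le> k" "d u y \<le> k" using d_le_ecc[of _ u] u xy le_trans by blast+
    moreover have "d c x = k" using c d_sym xy by metis
    ultimately have "d u c = 0"
      using geodesic_separates[of x y c u] xy c k u by linarith
    then show ?thesis using d_eq_0 u c by blast
  qed
  have "centre = {c}"
    unfolding centre_def using uniq order_trans[OF _ ecc_c] order_trans[OF ecc_c low] c by blast
  moreover have "\<forall>v\<in>V. d c v \<le> k" using d_le_ecc ecc_c le_trans by blast
  ultimately show ?thesis using c unfolding k_def by blast
qed

text \<open>The two middle vertices of a longest path are central. Their distances to any
  \<open>v\<close> are at most \<open>diam div 2 + 1\<close> and differ by bipartiteness, so the
  smaller is at most \<open>diam div 2\<close>.\<close>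

lemma centre_odd:
  assumes "odd diam"
  shows "\<exists>c\<in>centre. \<exists>c'\<in>centre. d c c' = 1 \<and> (\<forall>v\<in>V. min (d c v) (d c' v) \<le> diam div 2)"
proof -
  obtain x y where xy: "x \<in> V" "y \<in> V" "d x y = diam" using diam_attained by blast
  define k where "k = diam div 2"
  have k: "diam = k + Suc k" using assms using odd_two_times_div_two_succ[OF assms] unfolding k_def by linarith
  obtain c where c: "c \<in> V" "d x c = k" "d c y = Suc k" using geodesic_point xy k by metis
  obtain c' where c': "c' \<in> V" "d c c' = 1" "d c' y = k" using d_step c xy by blast
  have xc': "d x c' = Suc k"
    using d_tri[of x c' c] d_tri[of x y c'] xy c c' k by simp
  have ecc: "ecc c \<le> Suc k" "ecc c' \<le> Suc k"
    using ecc_midpoint[of x y c] ecc_midpoint[of x y c'] xy c c' xc' k by simp_all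
  have low: "Suc k \<le> ecc u" if "u \<in> V" for u using diam_le_ecc[of x y u] that xy k by linarith
  have "c \<in> centre" "c' \<in> centre"
    unfolding centre_def using order_trans[OF ecc(1) low] order_trans[OF ecc(2) low] c c' by blast+
  moreover have "min (d c v) (d c' v) \<le> k" if "v \<in> V" for v
  proof -
    have "d c v \<le> Suc k" "d c' v \<le> Suc k" using d_le_ecc ecc that le_trans by blast+
    moreover have "d c v \<noteq> d c' v" using adjacent_dist_neq[of v c c'] that c c' d_sym by metis
    ultimately show ?thesis by linarith
  qed
  ultimately show ?thesis using c' unfolding k_def by blast
qed

end

section \<open>The distance function of an undirected tree\<close>

context
  fixes G :: "('a, 'b) pre_digraph"
  assumes T: "undirected_tree G"
begin

interpretation graph G
  using T by (simp add: undirected_tree_def)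

lemma gdist_le: "awalk u p v \<Longrightarrow> gdist G u v \<le> length p"
  unfolding gdist_def by (rule Least_le) blast

lemma gdist_walk:
  assumes "u \<in> verts G" "v \<in> verts G"
  shows "\<exists>p. awalk u p v \<and> length p = gdist G u v"
proof -
  have "connected G" using T by (simp add: undirected_tree_def)
  then have "strongly_connected G"
    using symmetric_connected_imp_strongly_connected sym_arcs by blast
  then have "u \<rightarrow>\<^sup>*\<^bsub>G\<^esub> v" using assms by blast
  then obtain p where "awalk u p v" using reachable_awalk by blast
  then have "\<exists>n p. awalk u p v \<and> length p = n" by blast
  from LeastI_ex[OF this] show ?thesis unfolding gdist_def .
qed

lemma gdist_arc:
  assumes "u \<in> verts G" "v \<in> verts G"
  shows "gdist G u v = 1 \<longleftrightarrow> (\<exists>e\<in>arcs G. tail G e = u \<and> head G e = v)"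
proof
  assume "gdist G u v = 1"
  then obtain p where "awalk u p v" "length p = 1" using gdist_walk assms by metis
  then obtain e where "p = [e]" "awalk u [e] v" by (auto simp: length_Suc_conv)
  then show "\<exists>e\<in>arcs G. tail G e = u \<and> head G e = v" by (auto simp: awalk_simps)
next
  assume "\<exists>e\<in>arcs G. tail G e = u \<and> head G e = v"
  then obtain e where e: "e \<in> arcs G" "tail G e = u" "head G e = v" by blast
  then have "awalk u [e] v" by (auto simp: awalk_simps)
  from gdist_le[OF this] have "gdist G u v \<le> 1" by simp
  moreover have "gdist G u v \<noteq> 0"
  proof
    assume "gdist G u v = 0"
    then have "u = v" using gdist_walk[OF assms] awalk_empty_ends by fastforce
    then show False using e no_loops[OF e(1)] by simp
  qed
  ultimately show "gdist G u v = 1" by linarith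
qed

lemma out_degree_gdist:
  assumes "v \<in> verts G"
  shows "out_degree G v = card {w \<in> verts G. gdist G v w = 1}"
proof -
  have "inj_on (head G) (out_arcs G v)"
    by (rule inj_onI, rule no_multi_arcs) (simp_all add: arc_to_ends_def)
  moreover have "head G ` out_arcs G v = {w \<in> verts G. gdist G v w = 1}"
  proof (intro set_eqI iffI)
    fix w assume "w \<in> head G ` out_arcs G v"
    then have "w \<in> verts G" "\<exists>e\<in>arcs G. tail G e = v \<and> head G e = w" by auto
    then show "w \<in> {w \<in> verts G. gdist G v w = 1}" using gdist_arc[OF assms] by blast
  next
    fix w assume "w \<in> {w \<in> verts G. gdist G v w = 1}"
    then obtain e where "e \<in> arcs G" "tail G e = v" "head G e = w" using gdist_arc[OF assms] by blast
    then show "w \<in> head G ` out_arcs G v" by (auto simp: out_arcs_def)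
  qed
  ultimately show ?thesis unfolding out_degree_def using card_image by metis
qed

lemma gdist_sym_le:
  assumes "u \<in> verts G" "v \<in> verts G"
  shows "gdist G v u \<le> gdist G u v"
proof -
  have "\<exists>q. awalk v q u \<and> length q = length p" if "awalk u p v" for p
    using that
  proof (induction p arbitrary: u)
    case Nil
    then show ?case by (auto simp: awalk_simps)
  next
    case (Cons e p)
    then have e: "e \<in> arcs G" "tail G e = u" "awalk (head G e) p v" by (auto simp: awalk_simps)
    obtain q where q: "awalk v q (head G e)" "length q = length p" using Cons.IH e by blast
    obtain e' where "e' \<in> arcs G" "tail G e' = head G e" "head G e' = u"
      using sym_arcs e unfolding symmetric_conv by metis
    then have "awalk v (q @ [e']) u" using q by (auto simp: awalk_simps)
    then show ?case using q by (intro exI[of _ "q @ [e']"]) simp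
  qed
  moreover obtain p where "awalk u p v" "length p = gdist G u v" using gdist_walk[OF assms] by blast
  ultimately obtain q where "awalk v q u" "length q = gdist G u v" by metis
  from gdist_le[OF this(1)] this(2) show ?thesis by simp
qed

text \<open>The metric properties come from joining and splitting walks. For acyclicity, a walk
  between two neighbours of \<open>c\<close> that misses \<open>c\<close> is shortened to a path and
  closed up through \<open>c\<close> to a cycle.\<close>

lemma gdist_tree_metric: "tree_metric (verts G) (gdist G)"
proof
  show "finite (verts G)" by simp
  show "verts G \<noteq> {}"
    using T by (auto simp: undirected_tree_def connected_def strongly_connected_def)
  fix x y assume xy: "x \<in> verts G" "y \<in> verts G"
  show "gdist G x y = 0 \<longleftrightarrow> x = y"
  proof
    assume "gdist G x y = 0"
    then show "x = y" using gdist_walk[OF xy] by (auto simp: awalk_simps)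
  next
    assume "x = y"
    then have "awalk x [] y" using xy by (simp add: awalk_simps)
    from gdist_le[OF this] show "gdist G x y = 0" by simp
  qed
  show "gdist G x y = gdist G y x" using gdist_sym_le xy by (simp add: le_antisym)
  show "gdist G x y \<le> gdist G x c + gdist G c y" if c: "c \<in> verts G" for c
  proof -
    obtain p q where "awalk x p c" "length p = gdist G x c" "awalk c q y" "length q = gdist G c y"
      using gdist_walk[OF xy(1) c] gdist_walk[OF c xy(2)] by blast
    from gdist_le[OF awalk_appendI[OF this(1) this(3)]] this show ?thesis by simp
  qed
  show "\<exists>w\<in>verts G. gdist G x w = 1 \<and> gdist G w y = n" if n: "gdist G x y = Suc n" for n
  proof -
    obtain p where p: "awalk x p y" "length p = Suc n" using gdist_walk[OF xy] n by auto
    then obtain e q where q: "p = e # q" "length q = n" by (auto simp: length_Suc_conv)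
    then have e: "e \<in> arcs G" "tail G e = x" "awalk (head G e) q y" using p by (auto simp: awalk_simps)
    have w: "head G e \<in> verts G" using e by simp
    have "gdist G x (head G e) = 1" using gdist_arc[OF xy(1) w] e by auto
    moreover have "gdist G (head G e) y \<le> n" using gdist_le e q by blast
    moreover have "Suc n \<le> 1 + gdist G (head G e) y"
    proof -
      obtain r where "awalk (head G e) r y" "length r = gdist G (head G e) y"
        using gdist_walk[OF w xy(2)] by blast
      then have "awalk x (e # r) y" "length (e # r) = Suc (gdist G (head G e) y)"
        using e by (auto simp: awalk_simps)
      then show ?thesis using gdist_le[of x "e # r" y] n by simp
    qed
    ultimately have "gdist G x (head G e) = 1" "gdist G (head G e) y = n" by simp_all
    then show ?thesis using w by blast
  qed
next
  fix c a b
  assume c: "c \<in> verts G" and a: "a \<in> verts G" "gdist G c a = 1"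
    and b: "b \<in> verts G" "gdist G c b = 1" and ab: "a \<noteq> b"
  show "(a, b) \<notin> {(x, y). x \<in> verts G - {c} \<and> y \<in> verts G - {c} \<and> gdist G x y = 1}\<^sup>*"
  proof
    assume *: "(a, b) \<in> {(x, y). x \<in> verts G - {c} \<and> y \<in> verts G - {c} \<and> gdist G x y = 1}\<^sup>*"
    have ac: "a \<noteq> c"
    proof
      assume "a = c"
      then have "awalk c [] a" using c by (simp add: awalk_simps)
      from gdist_le[OF this] show False using a by simp
    qed
    have "\<exists>p. awalk a p b \<and> c \<notin> set (awalk_verts a p)"
      using *
    proof (induction rule: rtrancl_induct)
      case base
      then show ?case using a ac by (intro exI[of _ "[]"]) (auto simp: awalk_simps)
    next
      case (step y w)
      then obtain p where p: "awalk a p y" "c \<notin> set (awalk_verts a p)" by blast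
      have yw: "y \<in> verts G" "w \<in> verts G" "w \<noteq> c" "y \<noteq> c" "gdist G y w = 1" using step by auto
      then obtain e where e: "e \<in> arcs G" "tail G e = y" "head G e = w" using gdist_arc by blast
      then have ye: "awalk y [e] w" by (auto simp: awalk_simps)
      have "awalk a (p @ [e]) w" using awalk_appendI[OF p(1) ye] .
      moreover have "c \<notin> set (awalk_verts a (p @ [e]))"
        using set_awalk_verts_append[OF p(1) ye] p(2) yw e by simp
      ultimately show ?case by blast
    qed
    then obtain p where p: "awalk a p b" "c \<notin> set (awalk_verts a p)" by blast
    define q where "q = awalk_to_apath p"
    have "apath a q b" unfolding q_def using apath_awalk_to_apath p(1) by blast
    then have qd: "awalk a q b" "distinct (awalk_verts a q)" by (auto simp: apath_def)
    have q: "set (awalk_verts a q) \<subseteq> set (awalk_verts a p)"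
      using awalk_to_apath_subset[OF p(1)] set_awalk_verts[OF p(1)] set_awalk_verts[OF qd(1)]
      unfolding q_def by auto
    obtain e where e: "e \<in> arcs G" "tail G e = c" "head G e = a" using gdist_arc c a by blast
    obtain e2 where "e2 \<in> arcs G" "tail G e2 = c" "head G e2 = b" using gdist_arc c b by blast
    then obtain e' where e': "e' \<in> arcs G" "tail G e' = b" "head G e' = c"
      using sym_arcs unfolding symmetric_conv by metis
    have bc: "awalk b [e'] c" using e' by (auto simp: awalk_simps)
    have qe: "awalk a (q @ [e']) c" using awalk_appendI[OF qd(1) bc] .
    then have walk: "awalk c (e # q @ [e']) c" using e c by (auto simp: awalk_Cons_iff)
    have "awalk_verts a (q @ [e']) = awalk_verts a q @ [c]"
      using awalk_verts_append[OF qe] awlast_of_awalk[OF qd(1)] e' by simp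
    then have "distinct (tl (awalk_verts c (e # q @ [e'])))"
      using qd(2) q p(2) e by auto
    then have "cycle (e # q @ [e'])" using walk unfolding cycle_def by blast
    \<comment> \<open>Since \<open>a\<close> and \<open>b\<close> differ, the cycle is not the walk
      along an edge and back.\<close>
    moreover have "q \<noteq> []" using qd ab by (auto simp: awalk_simps)
    then have "3 \<le> length (e # q @ [e'])" by (cases q) auto
    ultimately show False using T unfolding undirected_tree_def by blast
  qed
qed

end

section \<open>Level-wise regular trees\<close>

definition (in tree_metric) depth :: "'a set \<Rightarrow> 'a \<Rightarrow> nat" where
  "depth C v = Min {d w v | w. w \<in> C}"

text \<open>The tree as seen from its center \<open>C\<close>, a vertex or an edge, with all
  vertices within distance \<open>h\<close>. The bound \<open>depth_le\<close> also makes the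
  vertices of level \<open>h\<close> childless.\<close>

locale level_regular_tree = tree_metric V d for V :: "'a set" and d :: "'a \<Rightarrow> 'a \<Rightarrow> nat" +
  fixes C :: "'a set" and h z :: nat and m :: "nat \<Rightarrow> nat"
  assumes C_sub: "C \<subseteq> V"
    and card_C: "card C = z"
    and z: "z = 1 \<or> z = 2"
    and C_adj: "\<And>c c'. c \<in> C \<Longrightarrow> c' \<in> C \<Longrightarrow> c \<noteq> c' \<Longrightarrow> d c c' = 1"
    and h: "1 \<le> h"
    and m0: "m 0 = 2"
    and m3: "\<And>i. 1 \<le> i \<Longrightarrow> i < h \<Longrightarrow> 3 \<le> m i"
    and depth_le: "\<And>v. v \<in> V \<Longrightarrow> depth C v \<le> h"
    and deg: "\<And>v. v \<in> V \<Longrightarrow> depth C v < h \<Longrightarrow> card {w \<in> V. d v w = 1} = m (depth C v)"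
begin

abbreviation l :: "'a \<Rightarrow> nat" where "l \<equiv> depth C"

lemma fin_C: "finite C" using C_sub fin finite_subset by blast

lemma C_ne: "C \<noteq> {}" using card_C z by auto

lemma l_att: "\<exists>w\<in>C. d w v = l v"
proof -
  have "l v \<in> {d w v | w. w \<in> C}"
    unfolding depth_def using fin_C C_ne by (intro Min_in) auto
  then obtain w where "w \<in> C" "l v = d w v" by blast
  then show ?thesis by metis
qed

lemma l_min: "w \<in> C \<Longrightarrow> l v \<le> d w v"
  unfolding depth_def using fin_C by (intro Min_le) auto

lemma l_lip:
  assumes "x \<in> V" "y \<in> V"
  shows "l x \<le> l y + d x y"
proof -
  obtain w where w: "w \<in> C" "d w y = l y" using l_att by blast
  then have "l x \<le> d w y + d y x" using l_min[of w x] d_tri[of w x y] C_sub assms by force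
  then show ?thesis using w d_sym assms by simp
qed

lemma l_eq_0: "v \<in> V \<Longrightarrow> l v = 0 \<longleftrightarrow> v \<in> C"
  using l_att[of v] l_min[of v v] d_eq_0 C_sub by (metis d_self le_zero_eq subsetD)

lemma C_dist: "c \<in> C \<Longrightarrow> c' \<in> C \<Longrightarrow> d c c' \<le> z - 1"
proof (cases "c = c'")
  case False
  assume c: "c \<in> C" "c' \<in> C"
  then have "card {c, c'} \<le> card C" using fin_C by (intro card_mono) auto
  then show ?thesis using False c C_adj[of c c'] card_C by simp
qed (use C_sub in auto)

text \<open>Go through the central vertices nearest to \<open>x\<close> and \<open>y\<close>, which
  are at most \<open>z - 1\<close> apart.\<close>

lemma d_upper:
  assumes "x \<in> V" "y \<in> V"
  shows "d x y \<le> l x + l y + (z - 1)"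
proof -
  obtain w w' where w: "w \<in> C" "d w x = l x" "w' \<in> C" "d w' y = l y" using l_att by metis
  have "d x y \<le> d x w + d w y" "d w y \<le> d w w' + d w' y" using d_tri w C_sub assms by blast+
  moreover have "d x w = l x" using w d_sym assms C_sub by auto
  ultimately show ?thesis using C_dist[of w w'] w by linarith
qed

text \<open>A neighbour of \<open>v\<close> that is no deeper than \<open>v\<close> reaches the
  center without passing \<open>v\<close>, and the center is connected outside \<open>v\<close>. Two
  such neighbours would thus be joined outside \<open>v\<close>.\<close>

lemma parent_unique:
  assumes "v \<in> V" "1 \<le> l v" "x \<in> V" "y \<in> V" "d v x = 1" "d v y = 1" "l x \<le> l v" "l y \<le> l v"
  shows "x = y"
proof -
  have av: "\<exists>s\<in>C. (x, s) \<in> avoid v" if x: "x \<in> V" "d v x = 1" "l x \<le> l v" for x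
  proof -
    obtain s where s: "s \<in> C" "d s x = l x" using l_att by blast
    have "s \<in> V" using s C_sub by blast
    moreover have "l v \<le> d v s" using l_min[OF s(1)] d_sym \<open>s \<in> V\<close> assms(1) by metis
    moreover have "d x s = l x" "d x v = 1" using s x d_sym \<open>s \<in> V\<close> assms(1) by metis+
    ultimately show ?thesis using avoid_short[of x s v] x assms(1) s by auto
  qed
  obtain s s' where s: "s \<in> C" "(x, s) \<in> avoid v" "s' \<in> C" "(y, s') \<in> avoid v"
    using av assms by metis
  have "s \<noteq> v" "s' \<noteq> v" "s \<in> V" "s' \<in> V" using s assms l_eq_0 C_sub by force+
  then have "(s, s') \<in> avoid v"
    using C_adj[OF s(1,3)] unfolding avoid_def by (cases "s = s'") auto
  then have "(x, y) \<in> avoid v" using s avoid_trans avoid_sym by blast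
  then show ?thesis using acyclic assms by blast
qed

section \<open>Children, descendants and sums over levels\<close>

definition kids :: "'a \<Rightarrow> 'a set" where
  "kids v = {w \<in> V. d v w = 1 \<and> l w = Suc (l v)}"

text \<open>Metric form of descent: every step from \<open>v\<close> to \<open>x\<close> goes one
  level down; \<open>v\<close> descends from itself.\<close>

definition desc :: "'a \<Rightarrow> 'a set" where
  "desc v = {x \<in> V. l x = d v x + l v}"

lemma fin_kids: "finite (kids v)" unfolding kids_def using fin by simp

lemma fin_desc: "finite (desc v)" unfolding desc_def using fin by simp

lemma desc_sub: "desc v \<subseteq> V" unfolding desc_def by blast

lemma desc_self: "v \<in> V \<Longrightarrow> v \<in> desc v" unfolding desc_def by simp

lemma l_desc: "x \<in> desc v \<Longrightarrow> l v \<le> l x" unfolding desc_def by simp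

text \<open>One neighbour of \<open>v\<close> is its parent, the next vertex towards the center; by
  \<open>parent_unique\<close> all others are children.\<close>

lemma card_kids:
  assumes "v \<in> V" "1 \<le> l v" "l v < h"
  shows "card (kids v) = m (l v) - 1"
proof -
  obtain s where s: "s \<in> C" "d s v = l v" using l_att by blast
  obtain k where k: "l v = Suc k" using assms(2) by (cases "l v") auto
  have "d v s = Suc k" using s k d_sym C_sub assms(1) by auto
  then obtain p where p: "p \<in> V" "d v p = 1" "d p s = k" using d_step s C_sub assms(1) by blast
  then have lp: "l p \<le> k" using l_min[OF s(1), of p] d_sym s C_sub by auto
  have "{w \<in> V. d v w = 1} = insert p (kids v)"
  proof (intro set_eqI iffI)
    fix w assume w: "w \<in> {w \<in> V. d v w = 1}"
    show "w \<in> insert p (kids v)"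
    proof (cases "w = p")
      case False
      then have "\<not> l w \<le> l v" using parent_unique[of v w p] w p assms lp k by auto
      moreover have "l w \<le> l v + 1" using l_lip[of w v] w assms(1) d_sym[of w v] by auto
      ultimately show ?thesis using w unfolding kids_def by auto
    qed simp
  qed (use p in \<open>auto simp: kids_def\<close>)
  moreover have "p \<notin> kids v" using lp k unfolding kids_def by auto
  ultimately show ?thesis using deg[OF assms(1,3)] fin_kids by simp
qed

lemma kids_leaf: "l v = h \<Longrightarrow> kids v = {}"
  unfolding kids_def using depth_le by force

lemma kid_desc:
  assumes "v \<in> V" "w \<in> kids v" "x \<in> desc w"
  shows "x \<in> desc v" "d v x = Suc (d w x)" "x \<noteq> v"
proof -
  have *: "x \<in> V" "w \<in> V" "d v w = 1" "l w = Suc (l v)" "l x = d w x + l w"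
    using assms unfolding kids_def desc_def by auto
  have "d v x \<le> 1 + d w x" using d_tri[of v x w] * assms by simp
  moreover have "l x \<le> l v + d v x" using l_lip[of x v] d_sym[of x v] * assms by simp
  ultimately show "x \<in> desc v" "d v x = Suc (d w x)" using * unfolding desc_def by auto
  then show "x \<noteq> v" using * by auto
qed

lemma desc_unfold:
  assumes "v \<in> V"
  shows "desc v = insert v (\<Union>w\<in>kids v. desc w)"
proof (intro set_eqI iffI)
  fix x assume x: "x \<in> desc v"
  show "x \<in> insert v (\<Union>w\<in>kids v. desc w)"
  proof (cases "d v x")
    case 0
    then show ?thesis using x assms d_eq_0 unfolding desc_def by auto
  next
    case (Suc n)
    have xV: "x \<in> V" "l x = Suc n + l v" using x Suc unfolding desc_def by auto
    obtain w where w: "w \<in> V" "d v w = 1" "d w x = n" using d_step Suc assms xV by blast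
    have "l w \<le> l v + 1" "l x \<le> l w + n"
      using l_lip[of w v] l_lip[of x w] d_sym[of w v] d_sym[of x w] w xV assms by auto
    then have "w \<in> kids v" "x \<in> desc w" using w xV unfolding kids_def desc_def by auto
    then show ?thesis by blast
  qed
qed (use assms desc_self kid_desc(1) in auto)

text \<open>The path from \<open>x\<close> to \<open>y\<close> has to pass \<open>v\<close>, so it
  falls short of the sum of the levels by at most \<open>2 * l v\<close>.\<close>

lemma kids_branch:
  assumes "v \<in> V" "w \<in> kids v" "w' \<in> kids v" "w \<noteq> w'" "x \<in> desc w" "y \<in> desc w'"
  shows "l x + l y \<le> d x y + 2 * l v"
proof -
  have *: "x \<in> V" "y \<in> V" "w \<in> V" "w' \<in> V" "d v w = 1" "d v w' = 1"
    using assms unfolding kids_def desc_def by auto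
  have "d v x = Suc (d w x)" "d v y = Suc (d w' y)" using kid_desc assms by blast+
  then have "d x v + d v y \<le> d x y" using branch[of v w w' x y] * assms by simp
  moreover have "l x = d v x + l v" "l y = d v y + l v"
    using kid_desc(1) assms unfolding desc_def by blast+
  ultimately show ?thesis using d_sym[of x v] * assms by simp
qed

lemma kids_disjoint:
  assumes "v \<in> V" "w \<in> kids v" "w' \<in> kids v" "w \<noteq> w'"
  shows "desc w \<inter> desc w' = {}"
proof (rule ccontr)
  assume "\<not> ?thesis"
  then obtain x where x: "x \<in> desc w" "x \<in> desc w'" by blast
  then have "l x + l x \<le> 2 * l v" using kids_branch[of v w w' x x] assms desc_sub by force
  moreover have "Suc (l v) \<le> l x" using l_desc[OF x(1)] assms unfolding kids_def by simp
  ultimately show False by simp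
qed

text \<open>The product counts the descendants on level \<open>i\<close>. The function
  \<open>F\<close> is arbitrary so that the number of vertices, the number of leaves and
  \<open>weight\<close> all come from one induction on the height of the subtree.\<close>

lemma sum_desc:
  fixes F :: "nat \<Rightarrow> int"
  assumes "v \<in> V" "1 \<le> l v"
  shows "(\<Sum>x\<in>desc v. F (l x)) = (\<Sum>i=l v..h. F i * (\<Prod>j=l v..<i. int (m j) - 1))"
  using assms
proof (induction "h - l v" arbitrary: v)
  case 0
  then have "l v = h" using depth_le[of v] by simp
  then show ?case using desc_unfold[of v] kids_leaf[of v] 0 by simp
next
  case (Suc n)
  define q where "q = l v"
  have q: "1 \<le> q" "q < h" using Suc unfolding q_def by auto
  have kid: "w \<in> V" "l w = Suc q" if "w \<in> kids v" for w
    using that unfolding kids_def q_def by auto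
  have v: "v \<notin> (\<Union>w\<in>kids v. desc w)" using kid_desc(3) Suc.prems by blast
  have fin2: "finite (\<Union>w\<in>kids v. desc w)" using fin_kids fin_desc by blast
  have "(\<Sum>x\<in>desc v. F (l x)) = F q + (\<Sum>x\<in>(\<Union>w\<in>kids v. desc w). F (l x))"
    unfolding desc_unfold[OF Suc.prems(1)] using v fin2 by (simp add: q_def)
  also have "(\<Sum>x\<in>(\<Union>w\<in>kids v. desc w). F (l x)) = (\<Sum>w\<in>kids v. \<Sum>x\<in>desc w. F (l x))"
    using fin_kids fin_desc kids_disjoint Suc.prems by (intro sum.UNION_disjoint) auto
  also have "\<dots> = (\<Sum>w\<in>kids v. \<Sum>i=Suc q..h. F i * (\<Prod>j=Suc q..<i. int (m j) - 1))"
  proof (rule sum.cong[OF refl])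
    fix w assume "w \<in> kids v"
    then show "(\<Sum>x\<in>desc w. F (l x)) = (\<Sum>i=Suc q..h. F i * (\<Prod>j=Suc q..<i. int (m j) - 1))"
      using Suc.hyps(1)[of w] Suc.hyps(2) kid[of w] unfolding q_def by simp
  qed
  also have "\<dots> = (int (m q) - 1) * (\<Sum>i=Suc q..h. F i * (\<Prod>j=Suc q..<i. int (m j) - 1))"
    using card_kids[of v] Suc.prems q m3[OF q] by (simp add: q_def of_nat_diff)
  also have "\<dots> = (\<Sum>i=Suc q..h. F i * (\<Prod>j=q..<i. int (m j) - 1))"
    unfolding sum_distrib_left
    by (rule sum.cong[OF refl]) (simp add: prod.atLeast_Suc_lessThan algebra_simps)
  also have "F q + \<dots> = (\<Sum>i=q..h. F i * (\<Prod>j=q..<i. int (m j) - 1))"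
    using q by (simp add: sum.atLeast_Suc_atMost)
  finally show ?case unfolding q_def .
qed

end

section \<open>Spreading out the vertices of a branch\<close>

context level_regular_tree
begin

text \<open>Number of descendants on level \<open>h\<close> of a vertex of level \<open>q\<close>,
  for \<open>1 \<le> q\<close>.\<close>

definition leaves :: "nat \<Rightarrow> nat" where
  "leaves q = (\<Prod>j=q..<h. m j - 1)"

text \<open>
  An enumeration of the descendants of \<open>v\<close> in which vertices at positions \<open>i\<close>, \<open>j\<close> have their
  lowest common ancestor at most \<open>\<bar>i - j\<bar> - 1\<close> levels below \<open>v\<close>. It is obtained by
  interleaving such enumerations of the subtrees of the children and putting \<open>v\<close> last.
\<close>

definition spread :: "'a \<Rightarrow> nat \<Rightarrow> (nat \<Rightarrow> 'a) \<Rightarrow> bool" where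
  "spread v M u \<longleftrightarrow> bij_betw u {..<M} (desc v) \<and> leaves (l v) \<le> M \<and>
     (\<forall>i<M. l (u i) = h \<longleftrightarrow> i < leaves (l v)) \<and>
     (\<forall>i j. i < j \<longrightarrow> j < M \<longrightarrow> l (u i) + l (u j) \<le> d (u i) (u j) + 2 * (l v - 1) + 2 * (j - i)) \<and>
     (\<forall>j<M. l (u j) + j \<le> l v - 1 + M)"

text \<open>Induction from level \<open>h\<close> towards the center. A single length
  \<open>M\<close> serves a whole level, so that the orders of the children can be interleaved. The
  last clause of \<open>spread\<close> says that levels near the end of the order are small; this
  permits moving a leaf there when there are two centers.\<close>

lemma spread_exists:
  assumes "1 \<le> q" "q \<le> h"
  shows "\<exists>M. \<forall>v\<in>V. l v = q \<longrightarrow> (\<exists>u. spread v M u)"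
  using assms
proof (induction "h - q" arbitrary: q)
  case 0
  then have q: "q = h" by simp
  have "spread v 1 (\<lambda>_. v)" if "v \<in> V" "l v = q" for v
    using desc_unfold[OF that(1)] kids_leaf[of v] that q 0
    by (auto simp: spread_def bij_betw_def leaves_def lessThan_Suc)
  then show ?case by blast
next
  case (Suc n)
  have q: "1 \<le> q" "q < h" using Suc by auto
  obtain M where M: "\<forall>v\<in>V. l v = Suc q \<longrightarrow> (\<exists>u. spread v M u)"
  proof -
    have "n = h - Suc q" using Suc.hyps(2) by simp
    then show thesis using Suc.hyps(1)[of "Suc q"] q that by auto
  qed
  define k where "k = m q - 1"
  have k: "2 \<le> k" using m3[OF q] unfolding k_def by simp
  have leaves_q: "leaves q = k * leaves (Suc q)"
    unfolding leaves_def k_def using q by (simp add: prod.atLeast_Suc_lessThan)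
  have "\<exists>u. spread v (k * M + 1) u" if v: "v \<in> V" "l v = q" for v
  proof -
    have kid: "w \<in> V" "l w = Suc q" if "w \<in> kids v" for w
      using that v unfolding kids_def by auto
    obtain U where U: "\<And>w. w \<in> kids v \<Longrightarrow> spread w M (U w)" using M kid by metis
    have "card (kids v) = k" using card_kids[of v] v q unfolding k_def by simp
    then obtain c where c: "bij_betw c {..<k} (kids v)"
      using ex_bij_betw_nat_finite[OF fin_kids, of v] by (auto simp: atLeast0LessThan)
    then have ck: "c r \<in> kids v" if "r < k" for r using that by (auto simp: bij_betw_def)
    have leM: "leaves (Suc q) \<le> M"
      using U[OF ck[of 0]] kid[OF ck[of 0]] k unfolding spread_def by simp
    \<comment> \<open>Position \<open>n\<close> takes entry \<open>n div k\<close> from the order of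
      child number \<open>n mod k\<close>.\<close>
    define u where "u = (\<lambda>n. if n < k * M then U (c (n mod k)) (n div k) else v)"
    have dm: "n mod k < k" "n div k < M" if "n < k * M" for n
      using that k by (simp_all add: less_mult_imp_div_less mult.commute)
    have u_eq: "u n = U (c (n mod k)) (n div k)" if "n < k * M" for n using that by (simp add: u_def)
    have u_last: "u (k * M) = v" by (simp add: u_def)
    have S: "spread (c (n mod k)) M (U (c (n mod k)))" if "n < k * M" for n
      using U ck dm(1) that by blast
    have u_desc: "u n \<in> desc (c (n mod k))" if "n < k * M" for n
      using S[OF that] dm[OF that] u_eq[OF that] unfolding spread_def bij_betw_def by auto
    have u_ne: "u n \<noteq> v" if "n < k * M" for n
      using kid_desc(3)[OF v(1) ck[OF dm(1)[OF that]] u_desc[OF that]] .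
    have inj: "inj_on u {..<k * M + 1}"
    proof (rule inj_onI)
      fix i j assume ij: "i \<in> {..<k * M + 1}" "j \<in> {..<k * M + 1}" "u i = u j"
      consider "i = k * M" "j = k * M" | "i < k * M" "j = k * M" | "i = k * M" "j < k * M"
        | "i < k * M" "j < k * M" using ij by fastforce
      then show "i = j"
      proof cases
        case 4
        have "c (i mod k) = c (j mod k)"
          using kids_disjoint[OF v(1) ck[OF dm(1)[OF 4(1)]] ck[OF dm(1)[OF 4(2)]]]
            u_desc[OF 4(1)] u_desc[OF 4(2)] ij(3) by auto
        then have mod: "i mod k = j mod k"
          using c dm(1)[OF 4(1)] dm(1)[OF 4(2)] by (auto simp: bij_betw_def inj_on_def)
        then have "U (c (i mod k)) (i div k) = U (c (i mod k)) (j div k)"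
          using u_eq 4 ij(3) by metis
        then have "i div k = j div k"
          using S[OF 4(1)] dm(2)[OF 4(1)] dm(2)[OF 4(2)]
          unfolding spread_def bij_betw_def inj_on_def by blast
        then show ?thesis using mod by (metis div_mult_mod_eq)
      qed (use u_last u_ne ij in force)+
    qed
    have "u ` {..<k * M + 1} = desc v"
    proof (intro set_eqI iffI)
      fix x assume "x \<in> u ` {..<k * M + 1}"
      then obtain n where n: "n < k * M + 1" "x = u n" by auto
      show "x \<in> desc v"
      proof (cases "n = k * M")
        case True
        then show ?thesis using n u_last desc_self v by simp
      next
        case False
        then have "n < k * M" using n by simp
        then show ?thesis using kid_desc(1)[OF v(1) ck u_desc] dm(1) n by blast
      qed
    next
      fix x assume x: "x \<in> desc v"
      show "x \<in> u ` {..<k * M + 1}"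
      proof (cases "x = v")
        case True
        then show ?thesis using u_last by force
      next
        case False
        then obtain w where w: "w \<in> kids v" "x \<in> desc w" using x desc_unfold[OF v(1)] by blast
        obtain r where r: "r < k" "c r = w" using c w(1) unfolding bij_betw_def by (metis imageE lessThan_iff)
        obtain i where i: "i < M" "U w i = x"
          using U[OF w(1)] w(2) unfolding spread_def bij_betw_def by (metis imageE lessThan_iff)
        have "i * k + r < Suc i * k" using r by simp
        also have "\<dots> \<le> M * k" using i by (intro mult_le_mono1) simp
        finally have less: "i * k + r < k * M" by (simp add: mult.commute)
        then have "u (i * k + r) = x" using u_eq[OF less] r i by simp
        then show ?thesis using less by (intro image_eqI[of _ _ "i * k + r"]) auto
      qed
    qed
    then have bij: "bij_betw u {..<k * M + 1} (desc v)" using inj by (simp add: bij_betw_def)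
    have uV: "u n \<in> V" if "n < k * M + 1" for n
      using bij that desc_sub by (force simp: bij_betw_def)
    have leaf: "l (u n) = h \<longleftrightarrow> n < leaves (l v)" if n: "n < k * M + 1" for n
    proof (cases "n < k * M")
      case True
      have "l (u n) = h \<longleftrightarrow> n div k < leaves (Suc q)"
        using S[OF True] dm[OF True] u_eq[OF True] kid[OF ck] unfolding spread_def by simp
      also have "\<dots> \<longleftrightarrow> n < k * leaves (Suc q)"
        using k by (simp add: div_less_iff_less_mult mult.commute)
      finally show ?thesis using leaves_q v by simp
    next
      case False
      then have "n = k * M" using n by simp
      then show ?thesis using u_last v q leaves_q mult_le_mono2[OF leM, of k] by auto
    qed
    have dist: "l (u i) + l (u j) \<le> d (u i) (u j) + 2 * (l v - 1) + 2 * (j - i)"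
      if ij: "i < j" "j < k * M + 1" for i j
    proof -
      have V: "u i \<in> V" "u j \<in> V" using uV ij by auto
      have i: "i < k * M" using ij by simp
      consider "j = k * M" | "j < k * M" "i mod k \<noteq> j mod k" | "j < k * M" "i mod k = j mod k"
        using ij by fastforce
      then show ?thesis
      proof cases
        case 1
        then show ?thesis using l_lip[OF V] u_last v q ij by simp
      next
        case 2
        have "c (i mod k) \<noteq> c (j mod k)"
          using 2 c dm(1)[OF i] dm(1)[OF 2(1)] by (auto simp: bij_betw_def inj_on_def)
        \<comment> \<open>Different subtrees meet only at \<open>v\<close>, one level deeper than
          the bound assumes; the term \<open>2 * (j - i)\<close> supplies the missing 2.\<close>
        then have "l (u i) + l (u j) \<le> d (u i) (u j) + 2 * l v"
          using kids_branch[OF v(1) ck[OF dm(1)[OF i]] ck[OF dm(1)[OF 2(1)]]]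
            u_desc[OF i] u_desc[OF 2(1)] by blast
        then show ?thesis using v q ij by simp
      next
        case 3
        have "i div k \<noteq> j div k" using 3 ij by (metis div_mult_mod_eq less_irrefl)
        then have less: "i div k < j div k" using div_le_mono[of i j k] ij by simp
        have "l (u i) + l (u j) \<le> d (u i) (u j) + 2 * q + 2 * (j div k - i div k)"
          using S[OF i] less dm(2)[OF 3(1)] u_eq[OF i] u_eq[OF 3(1)] kid[OF ck[OF dm(1)[OF i]]] 3(2)
          unfolding spread_def by simp
        \<comment> \<open>Within one subtree the bound starts one level deeper and is worse by 2.
          Interleaving multiplies the difference of positions by \<open>k\<close>, and
          \<open>2 \<le> k\<close> makes up for it.\<close>
        moreover have "j div k - i div k + 1 \<le> j - i"
        proof -
          obtain e where e: "j div k = i div k + e" "1 \<le> e" using less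
            by (metis One_nat_def Suc_leI add_diff_inverse_nat less_imp_not_less zero_less_diff)
          have "j = k * (i div k + e) + i mod k" using e 3 by (metis mult_div_mod_eq)
          then have "j = i + k * e" by (simp add: distrib_left)
          moreover have "2 * e \<le> k * e" using k by simp
          ultimately show ?thesis using e by linarith
        qed
        ultimately show ?thesis using v q by simp
      qed
    qed
    have last: "l (u j) + j \<le> l v - 1 + (k * M + 1)" if j: "j < k * M + 1" for j
    proof (cases "j < k * M")
      case True
      have "l (u j) + j div k \<le> q + M"
        using S[OF True] dm[OF True] u_eq[OF True] kid[OF ck] unfolding spread_def by force
      moreover have "j = k * (j div k) + j mod k" by simp
      moreover have "j mod k \<le> k - 1" using dm(1)[OF True] by simp
      \<comment> \<open>The child's bound gives level at most \<open>q + M - j div k\<close>. So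
        \<open>j - j div k\<close>, which is at most \<open>(k - 1) * (j div k + 1)\<close>, has to
        fit into \<open>(k - 1) * M\<close>.\<close>
      moreover have "(k - 1) * (j div k + 1) \<le> (k - 1) * M"
        using dm(2)[OF True] by (intro mult_le_mono2) simp
      moreover have "(k - 1) * (j div k + 1) = k * (j div k) - j div k + (k - 1)"
        by (simp add: diff_mult_distrib distrib_left)
      moreover have "(k - 1) * M = k * M - M" by (simp add: diff_mult_distrib)
      moreover have "j div k \<le> k * (j div k)" "M \<le> k * M" using k by simp_all
      ultimately show ?thesis using v q by linarith
    next
      case False
      then have "j = k * M" using j by simp
      then show ?thesis using u_last v q by simp
    qed
    have "leaves (l v) \<le> k * M + 1" 
      using mult_le_mono2[OF leM, of k] unfolding leaves_q v(2) by (rule le_trans) simp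
    then have "spread v (k * M + 1) u" unfolding spread_def using bij leaf dist last by blast
    then show ?thesis by blast
  qed
  then show ?case by blast
qed

section \<open>The two branches at the center\<close>

lemma central_kids:
  assumes "v \<in> C"
  shows "card (kids v) = 3 - z"
proof -
  have v: "v \<in> V" "l v = 0" using assms C_sub l_eq_0 by auto
  \<comment> \<open>Of the \<open>m 0 = 2\<close> neighbours, \<open>z - 1\<close> are central and
    the others are children.\<close>
  have eq: "{w \<in> V. d v w = 1} = (C - {v}) \<union> kids v"
  proof (intro set_eqI iffI)
    fix w assume w: "w \<in> {w \<in> V. d v w = 1}"
    then have "l w \<le> 1" "w \<noteq> v" using l_lip[of w v] d_sym[of w v] v by auto
    then show "w \<in> (C - {v}) \<union> kids v"
      using w v l_eq_0[of w] unfolding kids_def by (cases "l w") auto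
  next
    fix w assume "w \<in> (C - {v}) \<union> kids v"
    then show "w \<in> {w \<in> V. d v w = 1}" using C_adj assms C_sub unfolding kids_def by auto
  qed
  have "l w = 0" if "w \<in> C" for w using l_eq_0 C_sub that by blast
  then have "(C - {v}) \<inter> kids v = {}" unfolding kids_def by auto
  then have "card {w \<in> V. d v w = 1} = card (C - {v}) + card (kids v)"
    unfolding eq using fin_kids fin_C by (intro card_Un_disjoint) auto
  moreover have "card {w \<in> V. d v w = 1} = 2" using deg[of v] v h m0 by simp
  ultimately show ?thesis using card_C fin_C assms z by auto
qed

text \<open>A form common to both values of \<open>z\<close>: for \<open>z = 1\<close> the branches
  hang from the one center \<open>ca = cb\<close>, for \<open>z = 2\<close> each center carries one.
  Passing to the other branch, or to the center that carries it, crosses the central edge if there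
  is one, whence \<open>z - 1\<close>.\<close>

lemma two_branches:
  obtains ca cb a b where "ca \<in> C" "cb \<in> C" "\<forall>c\<in>C. c = ca \<or> c = cb"
    "z = 1 \<longleftrightarrow> ca = cb" "a \<in> kids ca" "b \<in> kids cb"
    "\<forall>x\<in>V. x \<in> C \<or> x \<in> desc a \<or> x \<in> desc b"
    "\<forall>x\<in>desc a. \<forall>y\<in>desc b. l x + l y + (z - 1) \<le> d x y"
    "\<forall>x\<in>desc a. l x + (z - 1) \<le> d cb x"
    "\<forall>y\<in>desc b. l y + (z - 1) \<le> d ca y"
proof -
  have cover: "x \<in> C \<union> (\<Union>c\<in>C. \<Union>w\<in>kids c. desc w)" if x: "x \<in> V" for x
  proof -
    obtain c where c: "c \<in> C" "d c x = l x" using l_att by blast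
    then have cV: "c \<in> V" "l c = 0" using C_sub l_eq_0 by blast+
    then have "x \<in> desc c" using c x unfolding desc_def by simp
    then have "x = c \<or> (\<exists>w\<in>kids c. x \<in> desc w)" using desc_unfold[OF cV(1)] by simp
    then show ?thesis using c(1) by blast
  qed
  show thesis
  proof (cases "z = 1")
    case True
    then obtain c where c: "C = {c}" using card_C card_1_singletonE by metis
    have "card (kids c) = 2" using central_kids[of c] c True by simp
    then obtain a b where ab: "kids c = {a, b}" "a \<noteq> b" by (auto simp: card_2_iff)
    have cV: "c \<in> V" "l c = 0" using c C_sub l_eq_0 by auto
    show thesis
    proof (rule that[of c c a b])
      show "\<forall>x\<in>V. x \<in> C \<or> x \<in> desc a \<or> x \<in> desc b"
        using cover ab c(1) by auto
      show "\<forall>x\<in>desc a. \<forall>y\<in>desc b. l x + l y + (z - 1) \<le> d x y"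
        using kids_branch[OF cV(1), of a b] ab True cV by auto
      have "l x + (z - 1) \<le> d c x" for x using l_min[of c x] c True by simp
      then show "\<forall>x\<in>desc a. l x + (z - 1) \<le> d c x" "\<forall>x\<in>desc b. l x + (z - 1) \<le> d c x"
        by blast+
    qed (use c ab True in auto)
  next
    case False
    then have z2: "z = 2" using z by simp
    then obtain ca cb where c: "C = {ca, cb}" "ca \<noteq> cb" using card_C by (auto simp: card_2_iff)
    have "card (kids ca) = 1" "card (kids cb) = 1" using central_kids c z2 by auto
    then obtain a b where ab: "kids ca = {a}" "kids cb = {b}" by (auto simp: card_1_singleton_iff)
    have cV: "ca \<in> V" "l ca = 0" "cb \<in> V" "l cb = 0" using c C_sub l_eq_0 by auto
    have adj: "d ca cb = 1" "d cb ca = 1" using C_adj c by auto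
    \<comment> \<open>By bipartiteness the distances of \<open>x\<close> to the two centers differ,
      and the one to its own center is the smaller.\<close>
    have far: "l x + 1 \<le> d c2 x" if c12: "c1 \<in> C" "c2 \<in> C" "c1 \<noteq> c2" "w \<in> kids c1" "x \<in> desc w"
      for c1 c2 w x
    proof -
      have V: "c1 \<in> V" "c2 \<in> V" "x \<in> V" using c12 C_sub desc_sub by auto
      have "x \<in> desc c1" using kid_desc(1)[OF V(1)] c12 by blast
      then have "d c1 x = l x" using l_eq_0[OF V(1)] c12(1) unfolding desc_def by auto
      moreover have "d x c1 \<noteq> d x c2" using adjacent_dist_neq[of x c1 c2] V C_adj c12 by blast
      ultimately show ?thesis using l_min[OF c12(2), of x] d_sym V by fastforce
    qed
    show thesis
    proof (rule that[of ca cb a b])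
      show "\<forall>x\<in>V. x \<in> C \<or> x \<in> desc a \<or> x \<in> desc b"
        using cover ab c(1) by auto
      show "\<forall>x\<in>desc a. l x + (z - 1) \<le> d cb x" using far[of ca cb a] c ab z2 by simp
      show yca: "\<forall>x\<in>desc b. l x + (z - 1) \<le> d ca x" using far[of cb ca b] c ab z2 by simp
      show "\<forall>x\<in>desc a. \<forall>y\<in>desc b. l x + l y + (z - 1) \<le> d x y"
      proof (intro ballI)
        fix x y assume xy: "x \<in> desc a" "y \<in> desc b"
        have V: "a \<in> V" "x \<in> V" "y \<in> V" "d ca a = 1" "l a = 1"
          using xy ab desc_sub cV unfolding kids_def by auto
        have "a \<noteq> cb" using V cV by auto
        moreover have "d a x \<le> d ca x" using kid_desc(2)[OF cV(1), of a x] ab xy by simp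
        moreover have "d cb y \<le> d ca y"
        proof -
          have "y \<in> desc cb" using kid_desc(1)[OF cV(3)] ab xy by blast
          then show ?thesis using l_min[of ca y] c cV unfolding desc_def by simp
        qed
        ultimately have "d x ca + d ca y \<le> d x y"
          using branch[of ca a cb x y] V cV adj by simp
        moreover have "l x \<le> d x ca" using l_min[of ca x] c d_sym[of x ca] V cV by simp
        moreover have "l y + (z - 1) \<le> d ca y" using yca xy(2) by blast
        ultimately show "l x + l y + (z - 1) \<le> d x y" by linarith
      qed
    qed (use c ab z2 in auto)
  qed
qed

end

section \<open>The lower bound\<close>

text \<open>Each inner \<open>e t\<close> occurs in two increments, each end in one. With levels for
  \<open>e\<close> and slack for \<open>g\<close> this evaluates the span of an ordered
  labelling.\<close>

lemma telescope:
  fixes F e g :: "nat \<Rightarrow> int"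
  assumes "\<And>t. t < N \<Longrightarrow> F (Suc t) = F t + (c - e t - e (Suc t) + g t)"
  shows "F N - F 0 = (\<Sum>t\<le>N. c - 2 * e t) - c + e 0 + e N + (\<Sum>t<N. g t)"
  using assms
proof (induction N)
  case (Suc N)
  then show ?case using Suc.prems[of N] by simp
qed simp

lemma sum_adjacent_le:
  fixes g :: "nat \<Rightarrow> int"
  assumes "\<And>t. t < N \<Longrightarrow> 0 \<le> g t"
  shows "(\<Sum>i=1..<N. g (i - 1) + g i) \<le> 2 * (\<Sum>t<N. g t)"
proof -
  \<comment> \<open>So far \<open>g k\<close> has been used only once; keeping track of this makes
    the induction work.\<close>
  have "(\<Sum>i=1..<Suc k. g (i - 1) + g i) \<le> 2 * (\<Sum>t<Suc k. g t) - g k" if "k < N" for k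
    using that
  proof (induction k)
    case (Suc k)
    then show ?case using assms[of "Suc k"] by simp
  qed (use assms[of 0] in simp)
  then show ?thesis using assms by (cases N) force+
qed

lemma strict_enumeration:
  fixes f :: "'a \<Rightarrow> nat"
  assumes "finite V" "inj_on f V"
  obtains u where "bij_betw u {..<card V} V" "\<And>i j. i < j \<Longrightarrow> j < card V \<Longrightarrow> f (u i) < f (u j)"
proof -
  have c: "card (f ` V) = card V" using assms(2) card_image by blast
  define xs where "xs = sorted_list_of_set (f ` V)"
  have xs: "set xs = f ` V" "distinct xs" "length xs = card V" "sorted_wrt (<) xs"
    using assms(1) c by (simp_all add: xs_def)
  have e: "bij_betw (nth xs) {..<card V} (f ` V)" using bij_betw_nth[OF xs(2)] xs(1,3) by simp
  have inv: "bij_betw (inv_into V f) (f ` V) V"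
    using assms(2) by (simp add: bij_betw_inv_into inj_on_imp_bij_betw)
  show thesis
  proof (rule that)
    show "bij_betw (inv_into V f \<circ> nth xs) {..<card V} V" using e inv bij_betw_trans by blast
    fix i j assume ij: "i < j" "j < card V"
    then have "xs ! i \<in> f ` V" "xs ! j \<in> f ` V" using xs(1,3) nth_mem[of _ xs] by auto
    then show "f ((inv_into V f \<circ> nth xs) i) < f ((inv_into V f \<circ> nth xs) j)"
      using sorted_wrt_nth_less[OF xs(4) ij(1)] ij xs(3) by (simp add: f_inv_into_f)
  qed
qed

context level_regular_tree
begin

lemma sum_levels:
  fixes F :: "nat \<Rightarrow> int"
  shows "(\<Sum>x\<in>V. F (l x)) =
    int z * F 0 + 2 * (\<Sum>i=1..h. F i * (\<Prod>j=1..<i. int (m j) - 1))"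
proof -
  obtain ca cb a b where br: "ca \<in> C" "cb \<in> C" "\<forall>c\<in>C. c = ca \<or> c = cb"
      "z = 1 \<longleftrightarrow> ca = cb" "a \<in> kids ca" "b \<in> kids cb"
      "\<forall>x\<in>V. x \<in> C \<or> x \<in> desc a \<or> x \<in> desc b"
      "\<forall>x\<in>desc a. \<forall>y\<in>desc b. l x + l y + (z - 1) \<le> d x y"
      "\<forall>x\<in>desc a. l x + (z - 1) \<le> d cb x"
      "\<forall>y\<in>desc b. l y + (z - 1) \<le> d ca y"
    by (rule two_branches)
  have C0: "l c = 0" if "c \<in> C" for c using l_eq_0 C_sub that by blast
  have ab: "a \<in> V" "b \<in> V" "l a = 1" "l b = 1" using br(1,2,5,6) C0 unfolding kids_def by simp_all
  have pos: "l x \<noteq> 0" if "x \<in> desc a \<union> desc b" for x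
    using that l_desc[of x a] l_desc[of x b] ab by auto
  have "x \<notin> desc b" if "x \<in> desc a" for x
    using br(8)[rule_format, of x x] pos[of x] subsetD[OF desc_sub that] that by auto
  then have dis: "desc a \<inter> desc b = {}" by blast
  have dis': "C \<inter> (desc a \<union> desc b) = {}" using pos C0 by blast
  have "V = C \<union> (desc a \<union> desc b)" using br(7) C_sub desc_sub by blast
  from arg_cong[OF this, of "sum (\<lambda>x. F (l x))"] have "(\<Sum>x\<in>V. F (l x)) = (\<Sum>x\<in>C. F (l x)) + (\<Sum>x\<in>desc a \<union> desc b. F (l x))"
    using sum.union_disjoint[OF fin_C _ dis'] fin_desc by simp
  moreover have "(\<Sum>x\<in>C. F (l x)) = int z * F 0" using C0 card_C by simp
  moreover have "(\<Sum>x\<in>desc a \<union> desc b. F (l x)) = (\<Sum>x\<in>desc a. F (l x)) + (\<Sum>x\<in>desc b. F (l x))"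
    by (rule sum.union_disjoint[OF fin_desc fin_desc dis])
  ultimately show ?thesis using sum_desc ab by simp
qed

text \<open>Number of vertices of level \<open>h\<close> in one branch, hence half of all of
  them.\<close>

definition leaf_pairs :: int where
  "leaf_pairs = (\<Prod>j=1..<h. int (m j) - 1)"

lemma leaf_pairs: "int (leaves 1) = leaf_pairs"
proof -
  have "int (m j - 1) = int (m j) - 1" if "j \<in> {1..<h}" for j
    using m3[of j] that by (simp add: of_nat_diff)
  then show ?thesis unfolding leaves_def leaf_pairs_def of_nat_prod by (rule prod.cong[OF refl])
qed

lemma card_leaves: "int (card {x \<in> V. l x = h}) = 2 * leaf_pairs"
proof -
  have "int (card {x \<in> V. l x = h}) = (\<Sum>x\<in>V. of_bool (l x = h))"
    using sum.inter_filter[OF fin, of "\<lambda>_. 1::int" "\<lambda>x. l x = h"] by (simp add: of_bool_def)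
  also have "\<dots> = 2 * (\<Sum>i=1..h. of_bool (i = h) * (\<Prod>j=1..<i. int (m j) - 1))"
    using sum_levels[of "\<lambda>i. of_bool (i = h)"] h by simp
  also have "(\<Sum>i=1..h. of_bool (i = h) * (\<Prod>j=1..<i. int (m j) - 1)) = leaf_pairs"
    using h by (simp add: leaf_pairs_def of_bool_def if_distrib[of "\<lambda>x. x * _"] sum.delta cong: if_cong)
  finally show ?thesis .
qed

text \<open>The sum that \<open>telescope\<close> produces; it does not depend on the order of the
  vertices.\<close>

definition weight :: int where
  "weight = (\<Sum>x\<in>V. 2 * int h + 1 - 2 * int (l x))"

text \<open>The last summand is the cost of the two end levels and the slack together. The order
  built below splits it, for \<open>z = 1\<close>, into 1 for ends of levels 0 and 1 and
  \<open>leaf_pairs\<close> of slack; for \<open>z = 2\<close>, both ends are central and all pairs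
  of leaves but one cost 2.\<close>

definition opt_span :: int where
  "opt_span = weight - (2 * int h + 1) + (if z = 1 then leaf_pairs + 1 else 2 * leaf_pairs - 2)"

text \<open>The radio condition with diameter plus one written as \<open>2 * h + z\<close>.\<close>

definition radio :: "('a \<Rightarrow> nat) \<Rightarrow> bool" where
  "radio f \<longleftrightarrow> (\<forall>u\<in>V. \<forall>v\<in>V. u \<noteq> v \<longrightarrow>
     2 * int h + int z - int (d u v) \<le> \<bar>int (f u) - int (f v)\<bar>)"

text \<open>The path may turn back at \<open>w\<close> on level 1, which saves one step on each
  side.\<close>

lemma branch_upper:
  assumes "x \<in> desc w" "y \<in> desc w" "w \<in> V" "l w = 1"
  shows "d x y + 2 \<le> l x + l y"
proof -
  have "x \<in> V" "y \<in> V" using assms desc_sub by auto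
  then show ?thesis using d_tri[of x y w] d_sym[of x w] assms unfolding desc_def by simp
qed

text \<open>A vertex of level \<open>h\<close> escapes its share of slack only at an end of the
  order or next to a center. The former raises an end level; the latter serves at most two vertices
  per center, and only one if the center is itself an end.\<close>

lemma span_lower:
  assumes rl: "radio f" and h2: "z = 1 \<longrightarrow> 2 \<le> h"
  shows "\<exists>u\<in>V. \<exists>v\<in>V. opt_span \<le> \<bar>int (f u) - int (f v)\<bar>"
proof -
  obtain ca cb a b where br: "ca \<in> C" "cb \<in> C" "\<forall>c\<in>C. c = ca \<or> c = cb"
      "z = 1 \<longleftrightarrow> ca = cb" "a \<in> kids ca" "b \<in> kids cb"
      "\<forall>x\<in>V. x \<in> C \<or> x \<in> desc a \<or> x \<in> desc b"
      "\<forall>x\<in>desc a. \<forall>y\<in>desc b. l x + l y + (z - 1) \<le> d x y"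
      "\<forall>x\<in>desc a. l x + (z - 1) \<le> d cb x"
      "\<forall>y\<in>desc b. l y + (z - 1) \<le> d ca y"
    by (rule two_branches)
  have C0: "l c = 0" if "c \<in> C" for c using l_eq_0 C_sub that by blast
  have ab: "a \<in> V" "b \<in> V" "l a = 1" "l b = 1" using br(1,2,5,6) C0 unfolding kids_def by simp_all
  have "inj_on f V"
  proof (rule inj_onI, rule ccontr)
    fix x y assume xy: "x \<in> V" "y \<in> V" "f x = f y" "x \<noteq> y"
    then have "2 * h + z \<le> d x y" using rl unfolding radio_def by force
    then show False using d_upper[of x y] depth_le[of x] depth_le[of y] xy z by linarith
  qed
  then obtain u where u: "bij_betw u {..<card V} V"
      and u_mono: "\<And>i j. i < j \<Longrightarrow> j < card V \<Longrightarrow> f (u i) < f (u j)"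
    using strict_enumeration fin by blast
  define N where "N = card V - 1"
  have "card {ca, a} \<le> card V" using br(1) ab C_sub fin by (intro card_mono) auto
  moreover have "ca \<noteq> a" using ab C0[OF br(1)] by force
  ultimately have N: "card V = Suc N" "0 < N" unfolding N_def by simp_all
  have u': "bij_betw u {..N} V" using u unfolding N(1) lessThan_Suc_atMost .
  have uV: "u t \<in> V" if "t \<le> N" for t using u' that by (auto simp: bij_betw_def)
  have gap: "2 * int h + int z - int (d (u s) (u t)) \<le> int (f (u t)) - int (f (u s))"
    if st: "s < t" "t \<le> N" for s t
  proof -
    have less: "f (u s) < f (u t)" using u_mono st N by simp
    have "u s \<in> V" "u t \<in> V" using uV st by auto
    then have "2 * int h + int z - int (d (u s) (u t)) \<le> \<bar>int (f (u s)) - int (f (u t))\<bar>"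
      using rl less unfolding radio_def by (metis less_irrefl)
    then show ?thesis using less by simp
  qed
  \<comment> \<open>The constant is \<open>2 * h + 1\<close> for both \<open>z\<close>, because the
    \<open>z - 1\<close> of \<open>d_upper\<close> cancels against \<open>2 * h + z\<close>.\<close>
  define g where "g t = int (f (u (Suc t))) - int (f (u t)) -
    (2 * int h + 1 - int (l (u t)) - int (l (u (Suc t))))" for t
  have g0: "0 \<le> g t" if "t < N" for t
    using gap[of t "Suc t"] d_upper[OF uV uV, of t "Suc t"] that z unfolding g_def by auto
  define G where "G = (\<Sum>t<N. g t)"
  have "int (f (u N)) - int (f (u 0)) =
      (\<Sum>t\<le>N. 2 * int h + 1 - 2 * int (l (u t))) - (2 * int h + 1) + int (l (u 0)) + int (l (u N)) + G"
    unfolding G_def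
    by (rule telescope[of N "\<lambda>t. int (f (u t))" _ "\<lambda>t. int (l (u t))"]) (simp add: g_def)
  moreover have "(\<Sum>t\<le>N. 2 * int h + 1 - 2 * int (l (u t))) = weight"
    unfolding weight_def using sum.reindex_bij_betw[OF u', of "\<lambda>x. 2 * int h + 1 - 2 * int (l x)"] .
  ultimately have span: "int (f (u N)) - int (f (u 0)) =
      weight - (2 * int h + 1) + int (l (u 0)) + int (l (u N)) + G" by simp
  define I where "I = {i. 0 < i \<and> i < N \<and> l (u i) = h \<and> u (i - 1) \<notin> C \<and> u (Suc i) \<notin> C}"
  have I_sub: "I \<subseteq> {1..<N}" unfolding I_def by auto
  \<comment> \<open>Among three consecutive vertices two share a branch, so their distance is
    \<open>z + 1\<close> below the bound of \<open>d_upper\<close>. If they are consecutive, their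
    gap alone has slack \<open>z + 1\<close>; if they are the outer two, the two gaps together have
    slack at least \<open>z\<close>, since the middle level is \<open>h\<close>.\<close>
  have I_gap: "int z \<le> g (i - 1) + g i" if i: "i \<in> I" for i
  proof -
    have i': "0 < i" "i < N" "l (u i) = h" "u (i - 1) \<notin> C" "u (Suc i) \<notin> C"
      using i unfolding I_def by auto
    have pr: "Suc (i - 1) = i" using i' by simp
    have V: "u (i - 1) \<in> V" "u i \<in> V" "u (Suc i) \<in> V" using uV i' by auto
    have "u i \<notin> C" using C0 i' h by force
    then have D: "u (i - 1) \<in> desc a \<union> desc b" "u i \<in> desc a \<union> desc b" "u (Suc i) \<in> desc a \<union> desc b"
      using V i' br(7) by blast+
    have near: "int (d (u s) (u t)) + 2 \<le> int (l (u s)) + int (l (u t))"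
      if "u s \<in> desc w \<and> u t \<in> desc w" "w = a \<or> w = b" for s t w
      using branch_upper[of "u s" w "u t"] ab that by auto
    consider (1) w where "u (i - 1) \<in> desc w \<and> u i \<in> desc w" "w = a \<or> w = b"
      | (2) w where "u i \<in> desc w \<and> u (Suc i) \<in> desc w" "w = a \<or> w = b"
      | (3) w where "u (i - 1) \<in> desc w \<and> u (Suc i) \<in> desc w" "w = a \<or> w = b"
      using D by blast
    then show ?thesis
    proof cases
      case 1
      then show ?thesis using near[OF 1] gap[of "i - 1" i] g0[of i] i' pr unfolding g_def by simp
    next
      case 2
      then show ?thesis using near[OF 2] gap[of i "Suc i"] g0[of "i - 1"] i' pr unfolding g_def by simp
    next
      case 3
      then show ?thesis using near[OF 3] gap[of "i - 1" "Suc i"] i' pr unfolding g_def by simp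
    qed
  qed
  have I_card: "int z * int (card I) \<le> 2 * G"
  proof -
    have "int z * int (card I) = (\<Sum>i\<in>I. int z)" by simp
    also have "\<dots> \<le> (\<Sum>i\<in>I. g (i - 1) + g i)" using I_gap by (rule sum_mono)
    also have "\<dots> \<le> (\<Sum>i=1..<N. g (i - 1) + g i)"
      using I_sub g0 by (intro sum_mono2) auto
    also have "\<dots> \<le> 2 * G" unfolding G_def using sum_adjacent_le g0 by blast
    finally show ?thesis .
  qed
  define Q where "Q = {p. p \<le> N \<and> u p \<in> C}"
  have finQ: "finite Q" unfolding Q_def by simp
  have "u ` Q = C" using u' C_sub unfolding Q_def bij_betw_def by blast
  moreover have "inj_on u Q" using u' unfolding Q_def bij_betw_def inj_on_def by auto
  ultimately have Q: "card Q = z" using card_C card_image by metis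
  define L where "L = {i. i \<le> N \<and> l (u i) = h}"
  have finL: "finite L" unfolding L_def by simp
  have "u ` L = {x \<in> V. l x = h}" using u' unfolding L_def bij_betw_def by blast
  moreover have "inj_on u L" using u' unfolding L_def bij_betw_def inj_on_def by auto
  ultimately have L: "int (card L) = 2 * leaf_pairs" using card_leaves card_image by metis
  \<comment> \<open>Positions next to a center. Position \<open>N\<close> has no successor and 0 no
    predecessor, so a center at an end contributes one position less.\<close>
  define K where "K = Suc ` (Q - {N}) \<union> (\<lambda>p. p - 1) ` (Q - {0})"
  have L_sub: "L \<subseteq> I \<union> ((L \<inter> {0}) \<union> ((L \<inter> {N}) \<union> K))"
  proof
    fix i assume i: "i \<in> L"
    show "i \<in> I \<union> ((L \<inter> {0}) \<union> ((L \<inter> {N}) \<union> K))"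
    proof (rule ccontr)
      assume "\<not> ?thesis"
      then have *: "i \<notin> I" "i \<noteq> 0" "i \<noteq> N" "i \<notin> K" using i by auto
      then have "i - 1 \<in> Q - {N} \<or> Suc i \<in> Q - {0}"
        using i unfolding I_def L_def Q_def by auto
      then have "i \<in> K" unfolding K_def using \<open>i \<noteq> 0\<close> by force
      then show False using * by blast
    qed
  qed
  define c0 c1 e0 e1 :: int where "c0 = of_bool (u 0 \<in> C)" and "c1 = of_bool (u N \<in> C)"
    and "e0 = of_bool (l (u 0) = h)" and "e1 = of_bool (l (u N) = h)"
  have "finite K" "finite I" unfolding K_def using finQ I_sub finite_subset by auto
  then have "card L \<le> card (I \<union> ((L \<inter> {0}) \<union> ((L \<inter> {N}) \<union> K)))"
    using L_sub finL by (intro card_mono) auto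
  also have "\<dots> \<le> card I + (card (L \<inter> {0}) + (card (L \<inter> {N}) + card K))"
    by (meson card_Un_le add_le_mono le_refl order_trans)
  finally have cL: "card L \<le> card I + (card (L \<inter> {0}) + (card (L \<inter> {N}) + card K))" .
  have "card K \<le> card (Q - {N}) + card (Q - {0})"
    unfolding K_def using finQ by (meson card_Un_le card_image_le add_le_mono finite_Diff order_trans)
  moreover have "int (card (Q - {N})) = int z - c1" "int (card (Q - {0})) = int z - c0"
    using finQ Q z unfolding c0_def c1_def by (auto simp: Q_def card_Diff_singleton_if)
  ultimately have K: "int (card K) \<le> 2 * int z - c0 - c1" by linarith
  have "int (card (L \<inter> {0})) = e0" "int (card (L \<inter> {N})) = e1"
    unfolding e0_def e1_def L_def by auto
  then have count: "2 * leaf_pairs \<le> int (card I) + e0 + e1 + 2 * int z - c0 - c1"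
    using cL K L by linarith
  \<comment> \<open>An end has level 0 if central, \<open>h\<close> if so indicated, and at least 1
    otherwise.\<close>
  have bounds: "1 - c0 + (int h - 1) * e0 \<le> int (l (u 0))" "1 - c1 + (int h - 1) * e1 \<le> int (l (u N))"
    using l_eq_0[OF uV, of 0] l_eq_0[OF uV, of N] C0[of "u 0"] C0[of "u N"] h
    unfolding c0_def c1_def e0_def e1_def by (auto simp: of_bool_def)
  have e: "0 \<le> e0" "0 \<le> e1" unfolding e0_def e1_def by auto
  have G0: "0 \<le> G" unfolding G_def using g0 by (intro sum_nonneg) auto
  have "opt_span \<le> int (f (u N)) - int (f (u 0))"
  proof (cases "h = 1")
    case True
    \<comment> \<open>This is the path with four vertices: the last summand of
      \<open>opt_span\<close> is 0, and nonnegative slack suffices.\<close>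
    then have "z = 2" using h2 z by auto
    moreover have "leaf_pairs = 1" by (subst leaf_pairs_def) (simp add: True)
    ultimately show ?thesis using span G0 unfolding opt_span_def by simp
  next
    case False
    then have "1 * e0 \<le> (int h - 1) * e0" "1 * e1 \<le> (int h - 1) * e1"
      using h e by (intro mult_right_mono; simp)+
    then have b: "1 - c0 + e0 \<le> int (l (u 0))" "1 - c1 + e1 \<le> int (l (u N))" using bounds by linarith+
    show ?thesis
    proof (cases "z = 1")
      case True
      \<comment> \<open>A single center cannot occupy both ends. The bounds then give ends plus
        slack at least \<open>leaf_pairs + 1/2\<close>, and integrality raises this to
        \<open>leaf_pairs + 1\<close>.\<close>
      have "c0 + c1 \<le> 1"
      proof (rule ccontr)
        assume "\<not> ?thesis"
        then have "{0, N} \<subseteq> Q" unfolding c0_def c1_def Q_def by (auto simp: of_bool_def split: if_splits)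
        then have "card {0, N} \<le> 1" using card_mono[OF finQ] Q True by metis
        then show False using N by simp
      qed
      then show ?thesis using span b count I_card True e unfolding opt_span_def by simp
    next
      case False
      then have "z = 2" using z by simp
      \<comment> \<open>With two centers \<open>G\<close> is at least \<open>card I\<close>, and the
        indicators of the ends cancel exactly.\<close>
      then show ?thesis using span b count I_card e unfolding opt_span_def by simp
    qed
  qed
  then show ?thesis using uV[of N] uV[of 0]
    by (intro bexI[of _ "u N"] bexI[of _ "u 0"]) auto
qed

end

section \<open>The upper bound\<close>

text \<open>Each of the \<open>k\<close> positions strictly in between adds
  \<open>c - 2 * e t\<close>, which is at least 1.\<close>

lemma increments_general:
  fixes F e g :: "nat \<Rightarrow> int"
  assumes step: "\<And>t. t < N \<Longrightarrow> F (Suc t) = F t + (c - e t - e (Suc t) + g t)"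
    and g: "\<And>t. t < N \<Longrightarrow> 0 \<le> g t" and e: "\<And>t. t \<le> N \<Longrightarrow> 1 \<le> c - 2 * e t"
    and "i + Suc k \<le> N"
  shows "c - e i - e (i + Suc k) + int k \<le> F (i + Suc k) - F i"
  using assms(4)
proof (induction k)
  case 0
  then show ?case using step[of i] g[of i] by simp
next
  case (Suc k)
  then show ?case using step[of "i + Suc k"] g[of "i + Suc k"] e[of "i + Suc k"] by simp
qed

text \<open>Going by double steps, the \<open>k + 1\<close> intermediate positions of the other
  parity add at least \<open>K\<close> each, slack included, and the \<open>k\<close> of the same
  parity at least 1 each.\<close>

lemma increments_same_parity:
  fixes F e g :: "nat \<Rightarrow> int"
  assumes step: "\<And>t. t < N \<Longrightarrow> F (Suc t) = F t + (c - e t - e (Suc t) + g t)"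
    and e: "\<And>t. t \<le> N \<Longrightarrow> 1 \<le> c - 2 * e t"
    and "i + 2 * Suc k \<le> N"
    and K: "\<And>t. i < t \<Longrightarrow> t < i + 2 * Suc k \<Longrightarrow> K \<le> c - 2 * e t + g (t - 1) + g t"
  shows "c - e i - e (i + 2 * Suc k) + (K + 1) * int (Suc k) - 1 \<le> F (i + 2 * Suc k) - F i"
  using assms(3) K
proof (induction k)
  case 0
  then show ?case using step[of i] step[of "Suc i"] "0.prems"(2)[of "Suc i"] by simp
next
  case (Suc k)
  define p where "p = i + 2 * Suc k"
  have IH: "c - e i - e p + (K + 1) * int (Suc k) - 1 \<le> F p - F i"
    unfolding p_def using Suc by simp
  have p: "Suc (Suc p) \<le> N" "i + 2 * Suc (Suc k) = Suc (Suc p)" using Suc.prems(1) unfolding p_def by simp_all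
  have "K \<le> c - 2 * e (Suc p) + g p + g (Suc p)"
    using Suc.prems(2)[of "Suc p"] unfolding p_def by simp
  then have "c - e p - e (Suc (Suc p)) + K \<le> F (Suc (Suc p)) - F p"
    using step[of p] step[of "Suc p"] p by simp
  moreover have "1 \<le> c - 2 * e p" using e[of p] p by simp
  ultimately show ?case unfolding p(2) using IH by (simp add: algebra_simps)
qed

context level_regular_tree
begin

text \<open>The order alternates between the branches, each in a spread order. Vertices of different
  branches are as far apart as their levels permit; for two vertices of one branch,
  \<open>spread\<close> limits the loss in distance and the slack between them compensates
  it.\<close>

lemma span_upper:
  "\<exists>f. radio f \<and> (\<forall>v\<in>V. int (f v) \<le> opt_span)"
proof -
  obtain ca cb a b where br: "ca \<in> C" "cb \<in> C" "\<forall>c\<in>C. c = ca \<or> c = cb"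
      "z = 1 \<longleftrightarrow> ca = cb" "a \<in> kids ca" "b \<in> kids cb"
      "\<forall>x\<in>V. x \<in> C \<or> x \<in> desc a \<or> x \<in> desc b"
      "\<forall>x\<in>desc a. \<forall>y\<in>desc b. l x + l y + (z - 1) \<le> d x y"
      "\<forall>x\<in>desc a. l x + (z - 1) \<le> d cb x"
      "\<forall>y\<in>desc b. l y + (z - 1) \<le> d ca y"
    by (rule two_branches)
  have C0: "l c = 0" if "c \<in> C" for c using l_eq_0 C_sub that by blast
  have ab: "a \<in> V" "b \<in> V" "l a = 1" "l b = 1" using br(1,2,5,6) C0 unfolding kids_def by simp_all
  have cV: "ca \<in> V" "cb \<in> V" using br(1,2) C_sub by auto
  obtain M where M: "\<forall>v\<in>V. l v = 1 \<longrightarrow> (\<exists>u. spread v M u)" using spread_exists[of 1] h by auto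
  obtain ua where ua: "spread a M ua" using M ab by blast
  obtain ub where ub: "spread b M ub" using M ab by blast
  define P where "P = leaves 1"
  have P: "int P = leaf_pairs" unfolding P_def by (rule leaf_pairs)
  have P1: "1 \<le> P" unfolding P_def leaves_def using m3 by (intro prod_ge_1) force
  have PM: "P \<le> M" using ua ab unfolding spread_def P_def by simp
  have bij_a: "bij_betw ua {..<M} (desc a)" and bij_b: "bij_betw ub {..<M} (desc b)"
    using ua ub unfolding spread_def by blast+
  have leaf_a: "l (ua i) = h \<longleftrightarrow> i < P" and leaf_b: "l (ub i) = h \<longleftrightarrow> i < P" if "i < M" for i
    using ua ub ab that unfolding spread_def P_def by auto
  have dist_a: "l (ua i) + l (ua j) \<le> d (ua i) (ua j) + 2 * (j - i)"
    and dist_b: "l (ub i) + l (ub j) \<le> d (ub i) (ub j) + 2 * (j - i)" if "i < j" "j < M" for i j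
    using ua ub ab that unfolding spread_def by force+
  have last_a: "l (ua j) + j \<le> M" if "j < M" for j
    using ua ab that unfolding spread_def by force
  text \<open>
    For two centres one leaf of the first branch is moved to the end of the order, next to the
    second centre, where it needs no slack.
  \<close>
  define r where "r i = (if z = 1 then i else if i = M - 1 then 0 else Suc i)" for i :: nat
  have M1: "1 \<le> M" using P1 PM by simp
  have r: "bij_betw r {..<M} {..<M}"
  proof (cases "z = 1")
    case True
    then have "r = id" unfolding r_def by auto
    then show ?thesis by simp
  next
    case False
    have "inj_on r {..<M}" using False unfolding r_def inj_on_def by auto
    moreover have "r ` {..<M} \<subseteq> {..<M}" using False M1 unfolding r_def by auto
    ultimately show ?thesis by (simp add: bij_betw_def endo_inj_surj)
  qed
  have r_lt: "r i < M" if "i < M" for i using r that by (auto simp: bij_betw_def)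
  have in_a: "ua (r i) \<in> desc a" and in_b: "ub i \<in> desc b" if "i < M" for i
    using bij_a bij_b r_lt[OF that] that by (auto simp: bij_betw_def)
  \<comment> \<open>Odd positions run through the branch of \<open>b\<close>, positive even ones
    through that of \<open>a\<close>. The order starts at \<open>ca\<close> and, for
    \<open>z = 2\<close>, ends at \<open>cb\<close> in position \<open>2 * M + 1\<close>.\<close>
  define u where "u t = (if even t then (if t = 0 then ca else ua (r (t div 2 - 1)))
    else (if t div 2 < M then ub (t div 2) else cb))" for t :: nat
  define N where "N = 2 * M + z - 1"
  have N: "z = 1 \<Longrightarrow> N = 2 * M" "z = 2 \<Longrightarrow> N = 2 * M + 1" unfolding N_def by simp_all
  have u_even: "u (2 * Suc i) = ua (r i)" if "i < M" for i using that unfolding u_def by simp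
  have u_odd: "u (2 * i + 1) = ub i" if "i < M" for i using that unfolding u_def by simp
  have u_0: "u 0 = ca" unfolding u_def by simp
  have u_N: "u (2 * M + 1) = cb" unfolding u_def by simp
  have index: "t = 0 \<or> (\<exists>i<M. t = 2 * Suc i) \<or> (\<exists>i<M. t = 2 * i + 1) \<or> (z = 2 \<and> t = 2 * M + 1)"
    if "t \<le> N" for t
  proof (cases "even t")
    case True
    then obtain k where k: "t = 2 * k" by blast
    then have "k \<le> M" using that N z by auto
    then show ?thesis using k by (cases k) auto
  next
    case False
    then obtain k where k: "t = 2 * k + 1" by (rule oddE)
    then show ?thesis using that N z by (cases "k < M") auto
  qed
  have "u ` {..N} = V"
  proof (intro set_eqI iffI)
    fix x assume "x \<in> u ` {..N}"
    then obtain t where t: "t \<le> N" "x = u t" by auto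
    moreover have "ua (r i) \<in> V" "ub i \<in> V" if "i < M" for i
      using in_a[OF that] in_b[OF that] that desc_sub by blast+
    ultimately show "x \<in> V" using index[of t] u_even u_odd u_0 u_N cV by auto
  next
    fix x assume "x \<in> V"
    then consider "x = ca" | "x = cb" "z = 2" | "x \<in> desc a" | "x \<in> desc b"
      using br(3,4,7) z by blast
    then show "x \<in> u ` {..N}"
    proof cases
      case 1
      then show ?thesis using u_0 by (intro image_eqI[of _ _ 0]) auto
    next
      case 2
      then show ?thesis using u_N N by (intro image_eqI[of _ _ "2 * M + 1"]) auto
    next
      case 3
      then obtain j where j: "j < M" "ua j = x" using bij_a unfolding bij_betw_def by (metis imageE lessThan_iff)
      then obtain i where "i < M" "r i = j" using r unfolding bij_betw_def by (metis imageE lessThan_iff)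
      then show ?thesis using j u_even[of i] N z by (intro image_eqI[of _ _ "2 * Suc i"]) auto
    next
      case 4
      then obtain j where j: "j < M" "ub j = x" using bij_b unfolding bij_betw_def by (metis imageE lessThan_iff)
      then show ?thesis using u_odd[of j] N z by (intro image_eqI[of _ _ "2 * j + 1"]) auto
    qed
  qed
  moreover have "card V = Suc N"
  proof -
    have "(\<Sum>x\<in>V. 1::int) = int z * 1 + 2 * (\<Sum>i=1..h. 1 * (\<Prod>j=1..<i. int (m j) - 1))"
      by (rule sum_levels[of "\<lambda>_. 1"])
    moreover have "(\<Sum>x\<in>desc a. 1::int) = (\<Sum>i=1..h. 1 * (\<Prod>j=1..<i. int (m j) - 1))"
      using sum_desc[of a "\<lambda>_. 1"] ab by simp
    moreover have "card (desc a) = M" using bij_betw_same_card[OF bij_a] by simp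
    ultimately have "int (card V) = int z + 2 * int M" by simp
    then show ?thesis unfolding N_def using z by auto
  qed
  ultimately have bij: "bij_betw u {..N} V"
    by (simp add: bij_betw_def eq_card_imp_inj_on)
  have uV: "u t \<in> V" if "t \<le> N" for t using bij that by (auto simp: bij_betw_def)
  \<comment> \<open>For \<open>z = 1\<close> the leaves \<open>ub i\<close> and \<open>ua i\<close>
    in positions \<open>2 * i + 1\<close> and \<open>2 * i + 2\<close> share slack 1. For
    \<open>z = 2\<close> the leaves \<open>ua i\<close> and \<open>ub i\<close> in positions
    \<open>2 * i\<close> and \<open>2 * i + 1\<close> share slack 2 when \<open>1 \<le> i\<close>;
    the leaves \<open>ub 0\<close> and \<open>ua 0\<close> stand next to \<open>ca\<close> and
    \<open>cb\<close>.\<close>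
  define g :: "nat \<Rightarrow> nat" where "g t = (if z = 1 then (if odd t \<and> t < 2 * P then 1 else 0)
    else if even t \<and> 2 \<le> t \<and> t < 2 * P then 2 else 0)" for t
  have sum_g: "(\<Sum>t<N. int (g t)) = (if z = 1 then leaf_pairs else 2 * leaf_pairs - 2)"
  proof -
    have pair: "(\<Sum>t<2 * k. int (g t)) = (\<Sum>i<k. int (g (2 * i)) + int (g (2 * i + 1)))" for k
      by (induction k) simp_all
    show ?thesis
    proof (cases "z = 1")
      case True
      have "(\<Sum>t<N. int (g t)) = (\<Sum>i<M. of_bool (i < P))"
        unfolding N(1)[OF True] pair using True by (intro sum.cong) (auto simp: g_def)
      also have "\<dots> = (\<Sum>i\<in>{..<P}. 1)"
        using PM by (intro sum.mono_neutral_cong_right) auto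
      finally show ?thesis using True P by simp
    next
      case False
      then have z2: "z = 2" using z by simp
      have "g (2 * M) = 0" using PM False by (simp add: g_def)
      have "(\<Sum>t<N. int (g t)) = (\<Sum>i<M. 2 * of_bool (1 \<le> i \<and> i < P))"
      proof -
        have "int (g (2 * i)) + int (g (2 * i + 1)) = 2 * of_bool (1 \<le> i \<and> i < P)" for i
          using False by (auto simp: g_def)
        moreover have "(\<Sum>t<N. int (g t)) = (\<Sum>t<2 * M. int (g t))"
          unfolding N(2)[OF z2] using \<open>g (2 * M) = 0\<close> by simp
        ultimately show ?thesis unfolding pair by simp
      qed
      also have "\<dots> = (\<Sum>i\<in>{1..<P}. 2)"
        using PM by (intro sum.mono_neutral_cong_right) auto
      finally show ?thesis using False P P1 by simp
    qed
  qed
  \<comment> \<open>Levels are at most \<open>h\<close>, so the natural subtraction does not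
    truncate.\<close>
  define F where "F t = (\<Sum>s<t. 2 * h + 1 - l (u s) - l (u (Suc s)) + g s)" for t
  have step: "int (F (Suc t)) = int (F t) +
      ((2 * int h + 1) - int (l (u t)) - int (l (u (Suc t))) + int (g t))" if "t < N" for t
    using depth_le[OF uV, of t] depth_le[OF uV, of "Suc t"] that unfolding F_def by simp
  have l1: "1 \<le> 2 * int h + 1 - 2 * int (l (u t))" if "t \<le> N" for t
    using depth_le[OF uV[OF that]] by simp
  \<comment> \<open>A vertex of level less than \<open>h\<close> contributes at least 3, one of
    level \<open>h\<close> contributes 1 and its slack \<open>z\<close>. Positions 1 and
    \<open>2 * M\<close> carry no slack for \<open>z = 2\<close>, but never lie strictly between two
    positions of one branch.\<close>
  have key: "1 + int z \<le> 2 * int h + 1 - 2 * int (l (u t)) + int (g (t - 1)) + int (g t)"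
    if t: "2 \<le> t" "t < 2 * M" for t
  proof (cases "l (u t) = h")
    case False
    have "t \<le> N" using t N z by auto
    then have "l (u t) < h" using depth_le[OF uV[of t]] False by simp
    then show ?thesis using z by auto
  next
    case True
    show ?thesis
    proof (cases "even t")
      case even: True
      then obtain k where k: "t = 2 * k" by blast
      then obtain i where i: "k = Suc i" "Suc i < M" using t by (cases k) auto
      then have "r i < P" using leaf_a[OF r_lt, of i] u_even[of i] True k by simp
      then show ?thesis using True z k i unfolding g_def r_def by (auto split: if_splits)
    next
      case False
      then obtain i where i: "t = 2 * i + 1" by (rule oddE)
      then have "i < P" "1 \<le> i" using leaf_b[of i] u_odd[of i] True t by auto
      then show ?thesis using True z i unfolding g_def by (auto split: if_splits)
    qed
  qed
  have gen: "2 * int h + 1 - int (l (u i)) - int (l (u j)) + (int j - int i - 1) \<le> int (F j) - int (F i)"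
    if ij: "i < j" "j \<le> N" for i j
  proof -
    obtain k where k: "j = i + Suc k" using ij(1) less_iff_Suc_add by auto
    have "2 * int h + 1 - int (l (u i)) - int (l (u (i + Suc k))) + int k \<le> int (F (i + Suc k)) - int (F i)"
      using step l1 ij(2) unfolding k
      by (intro increments_general[where N = N and e = "\<lambda>t. int (l (u t))" and g = "\<lambda>t. int (g t)"]) simp_all
    then show ?thesis using k by simp
  qed
  have same: "2 * int h + 1 - int (l (u i)) - int (l (u (i + 2 * k))) + (2 + int z) * int k - 1
      \<le> int (F (i + 2 * k)) - int (F i)" if ik: "1 \<le> i" "1 \<le> k" "i + 2 * k \<le> 2 * M" for i k
  proof -
    obtain k' where k': "k = Suc k'" using ik(2) by (cases k) auto
    have "i + 2 * Suc k' \<le> N" using ik k' N z by auto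
    then have "2 * int h + 1 - int (l (u i)) - int (l (u (i + 2 * Suc k'))) + (1 + int z + 1) * int (Suc k') - 1
      \<le> int (F (i + 2 * Suc k')) - int (F i)"
      using step l1 key ik k'
      by (intro increments_same_parity[where N = N and e = "\<lambda>t. int (l (u t))" and g = "\<lambda>t. int (g t)"]) auto
    then show ?thesis using k' by (simp add: algebra_simps)
  qed
  have dist_ra: "l (ua (r i)) + l (ua (r j)) \<le> d (ua (r i)) (ua (r j)) + 2 * (j - i)"
    if ij: "i < j" "j < M" for i j
  proof -
    consider "z = 1" | "z = 2" "j < M - 1" | "z = 2" "j = M - 1" using z ij by linarith
    then show ?thesis
    proof cases
      case 1
      then show ?thesis using dist_a ij by (simp add: r_def)
    next
      case 2
      then show ?thesis using dist_a[of "Suc i" "Suc j"] ij by (simp add: r_def)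
    next
      case 3
      \<comment> \<open>For the moved leaf only the difference of levels bounds the distance from
        below; \<open>last_a\<close> covers the loss \<open>2 * l (ua (Suc i))\<close>.\<close>
      then have eq: "r i = Suc i" "r j = 0" using ij by (simp_all add: r_def)
      have "ua (Suc i) \<in> V" "ua 0 \<in> V" using in_a[of i] in_a[of j] eq ij desc_sub by force+
      then have "l (ua 0) \<le> l (ua (Suc i)) + d (ua (Suc i)) (ua 0)"
        using l_lip[of "ua 0" "ua (Suc i)"] d_sym[of "ua 0" "ua (Suc i)"] by simp
      moreover have "l (ua (Suc i)) + Suc i \<le> M" using last_a[of "Suc i"] ij 3 by simp
      ultimately show ?thesis using eq ij 3 by simp
    qed
  qed
  have radio_ij: "2 * int h + int z - int (d (u i) (u j)) \<le> int (F j) - int (F i)"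
    if ij: "i < j" "j \<le> N" for i j
  proof -
    have iN: "i \<le> N" using ij by simp
    have V: "u i \<in> V" "u j \<in> V" using uV ij by auto
    \<comment> \<open>Enough if the distance falls short of its maximum by at most the number of
      positions in between.\<close>
    have far: ?thesis if "l (u i) + l (u j) + (z - 1) \<le> d (u i) (u j) + (j - i - 1)"
      using gen[OF ij] that ij(1) z by auto
    consider (1) "i = 0" "z = 2" "j = 2 * M + 1"
      | (2) q where "i = 0" "q < M" "j = 2 * Suc q"
      | (3) q where "i = 0" "q < M" "j = 2 * q + 1"
      | (4) p where "p < M" "i = 2 * Suc p" "z = 2" "j = 2 * M + 1"
      | (5) p where "p < M" "i = 2 * p + 1" "z = 2" "j = 2 * M + 1"
      | (6) p q where "p < M" "i = 2 * Suc p" "q < M" "j = 2 * q + 1"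
      | (7) p q where "p < M" "i = 2 * p + 1" "q < M" "j = 2 * Suc q"
      | (8) p q where "p < M" "i = 2 * Suc p" "q < M" "j = 2 * Suc q"
      | (9) p q where "p < M" "i = 2 * p + 1" "q < M" "j = 2 * q + 1"
      using index[OF iN] index[OF ij(2)] ij(1) by (elim disjE exE conjE; force)
    then show ?thesis
    proof cases
      case 1
      then have "d ca cb = 1" using br(1,2,4) C_adj by auto
      then show ?thesis using gen[OF ij] 1 u_0 u_N C0 br(1,2) by simp
    next
      case 2
      \<comment> \<open>The central edge is not crossed here; the vertex in position 1 makes up for
        \<open>z - 1\<close>.\<close>
      have "l (u j) \<le> d (u i) (u j)" using l_min[OF br(1)] u_0 2 by simp
      then show ?thesis using far 2 u_0 C0[OF br(1)] z by auto
    next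
      case 3
      have "l (u j) + (z - 1) \<le> d (u i) (u j)" using br(10) in_b[OF 3(2)] u_odd[OF 3(2)] u_0 3 by simp
      then show ?thesis using far 3 u_0 C0[OF br(1)] by simp
    next
      case 4
      have "l (u i) + (z - 1) \<le> d (u j) (u i)" using br(9) in_a[OF 4(1)] u_even[OF 4(1)] u_N 4 by simp
      then show ?thesis using far 4 u_N C0[OF br(2)] d_sym V by simp
    next
      case 5
      have "l (u i) \<le> d (u j) (u i)" using l_min[OF br(2)] u_N 5 by simp
      then show ?thesis using far 5 u_N C0[OF br(2)] d_sym V by simp
    next
      case 6
      have "l (u i) + l (u j) + (z - 1) \<le> d (u i) (u j)"
        using br(8) in_a[OF 6(1)] in_b[OF 6(3)] u_even[OF 6(1)] u_odd[OF 6(3)] 6 by simp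
      then show ?thesis using far by simp
    next
      case 7
      have "l (u j) + l (u i) + (z - 1) \<le> d (u j) (u i)"
        using br(8) in_b[OF 7(1)] in_a[OF 7(3)] u_odd[OF 7(1)] u_even[OF 7(3)] 7 by simp
      then show ?thesis using far d_sym[OF V] by simp
    next
      case 8
      then have pq: "p < q" using ij by simp
      define k where "k = q - p"
      have k: "1 \<le> k" "j = i + 2 * k" using 8 pq unfolding k_def by simp_all
      have "l (u i) + l (u j) \<le> d (u i) (u j) + 2 * k"
        using dist_ra[OF pq] u_even[OF 8(1)] u_even[OF 8(3)] 8 unfolding k_def by simp
      \<comment> \<open>Each of the \<open>k\<close> double steps gains \<open>2 + z\<close>: the
        loss in distance takes 2 per step, while \<open>z\<close> is needed only once.\<close>
      moreover have "int z + 2 * int k \<le> (2 + int z) * int k"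
        using k(1) z by (auto simp: algebra_simps)
      ultimately show ?thesis using same[of i k] k 8 z by auto
    next
      case 9
      then have pq: "p < q" using ij by simp
      define k where "k = q - p"
      have k: "1 \<le> k" "j = i + 2 * k" using 9 pq unfolding k_def by simp_all
      have "l (u i) + l (u j) \<le> d (u i) (u j) + 2 * k"
        using dist_b[OF pq] u_odd[OF 9(1)] u_odd[OF 9(3)] 9 ij unfolding k_def by simp
      moreover have "int z + 2 * int k \<le> (2 + int z) * int k"
        using k(1) z by (auto simp: algebra_simps)
      ultimately show ?thesis using same[of i k] k 9 z by auto
    qed
  qed
  have F_0: "F 0 = 0" unfolding F_def by simp
  have F_mono: "F s \<le> F t" if "s \<le> t" for s t
    unfolding F_def using that by (intro sum_mono2) auto
  have "int (F N) - int (F 0) = (\<Sum>t\<le>N. 2 * int h + 1 - 2 * int (l (u t))) - (2 * int h + 1)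
      + int (l (u 0)) + int (l (u N)) + (\<Sum>t<N. int (g t))"
    by (rule telescope[of N "\<lambda>t. int (F t)" _ "\<lambda>t. int (l (u t))"]) (rule step)
  moreover have "(\<Sum>t\<le>N. 2 * int h + 1 - 2 * int (l (u t))) = weight"
    unfolding weight_def using sum.reindex_bij_betw[OF bij, of "\<lambda>x. 2 * int h + 1 - 2 * int (l x)"] .
  moreover have "l (u 0) = 0" using u_0 C0 br(1) by simp
  \<comment> \<open>For \<open>z = 1\<close> the last vertex ends a spread order, where
    \<open>last_a\<close> leaves level at most 1.\<close>
  moreover have "l (u N) \<le> (if z = 1 then 1 else 0)"
  proof (cases "z = 1")
    case True
    have "u N = ua (M - 1)" using u_even[of "M - 1"] N(1)[OF True] M1 True by (simp add: r_def)
    then show ?thesis using last_a[of "M - 1"] M1 True by simp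
  next
    case False
    then show ?thesis using u_N N(2) C0 br(2) z by auto
  qed
  ultimately have F_N: "int (F N) \<le> opt_span"
    unfolding opt_span_def using sum_g F_0 by (auto split: if_splits)
  define f where "f v = F (the_inv_into {..N} u v)" for v
  have f_u: "f (u t) = F t" if "t \<le> N" for t
    using bij that unfolding f_def bij_betw_def by (simp add: the_inv_into_f_f)
  have surj: "\<exists>t\<le>N. x = u t" if "x \<in> V" for x using bij that unfolding bij_betw_def by auto
  have "radio f"
    unfolding radio_def
  proof (intro ballI impI)
    fix x y assume xy: "x \<in> V" "y \<in> V" "x \<noteq> y"
    obtain i j where i: "i \<le> N" "x = u i" and j: "j \<le> N" "y = u j" using surj xy by meson
    then have "i \<noteq> j" using xy by blast
    then consider "i < j" | "j < i" by linarith
    then show "2 * int h + int z - int (d x y) \<le> \<bar>int (f x) - int (f y)\<bar>"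
    proof cases
      case 1
      then show ?thesis using radio_ij[OF 1 j(1)] f_u i j by simp
    next
      case 2
      then show ?thesis using radio_ij[OF 2 i(1)] f_u i j d_sym[OF xy(1,2)] by simp
    qed
  qed
  moreover have "int (f v) \<le> opt_span" if "v \<in> V" for v
    using surj[OF that] f_u F_mono F_N by force
  ultimately show ?thesis by blast
qed

end

section \<open>The radio number\<close>

text \<open>The level-1 term of \<open>weight\<close> splits off as \<open>4 * h - 2\<close>;
  shifting the other levels by one turns the coefficient \<open>4 * h + 2 - 4 * i\<close> into
  \<open>4 * (h - i) - 2\<close>.\<close>

lemma (in level_regular_tree) opt_span_eq:
  "opt_span =
    (if z = 1
     then (\<Sum>i = 1..h-1. (4 * (int h - int i) - 2) * (\<Prod>j = 1..i. (int (m j) - 1)))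
            + (\<Prod>i = 1..h-1. (int (m i) - 1)) + 4 * int h - 1
     else (\<Sum>i = 1..h-1. (4 * (int h - int i) - 2) * (\<Prod>j = 1..i. (int (m j) - 1)))
            + 2 * (\<Prod>i = 1..h-1. (int (m i) - 1)) + 6 * int h - 3)"
proof -
  define S where "S = (\<Sum>i = 1..h-1. (4 * (int h - int i) - 2) * (\<Prod>j = 1..i. (int (m j) - 1)))"
  have prod: "{1..<Suc i} = {1..i}" for i by auto
  obtain k where k: "h = Suc k" using h by (cases h) auto
  have "weight = int z * (2 * int h + 1) +
      2 * (\<Sum>i=1..h. (2 * int h + 1 - 2 * int i) * (\<Prod>j=1..<i. int (m j) - 1))"
    unfolding weight_def using sum_levels[of "\<lambda>i. 2 * int h + 1 - 2 * int i"] by simp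
  also have "2 * (\<Sum>i=1..h. (2 * int h + 1 - 2 * int i) * (\<Prod>j=1..<i. int (m j) - 1)) =
      (\<Sum>i=1..h. (4 * int h + 2 - 4 * int i) * (\<Prod>j=1..<i. int (m j) - 1))"
    unfolding sum_distrib_left by (rule sum.cong) (simp_all add: algebra_simps)
  also have "\<dots> = 4 * int h - 2 + (\<Sum>i=Suc 1..h. (4 * int h + 2 - 4 * int i) * (\<Prod>j=1..<i. int (m j) - 1))"
    using h by (simp add: sum.atLeast_Suc_atMost)
  also have "(\<Sum>i=Suc 1..h. (4 * int h + 2 - 4 * int i) * (\<Prod>j=1..<i. int (m j) - 1)) = S"
    unfolding S_def k sum.shift_bounds_cl_Suc_ivl prod by (rule sum.cong) simp_all
  finally have w: "weight = int z * (2 * int h + 1) + (4 * int h - 2 + S)" .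
  have "leaf_pairs = (\<Prod>i = 1..h-1. (int (m i) - 1))"
    unfolding leaf_pairs_def using prod[of k] k by simp
  then show ?thesis unfolding opt_span_def w S_def[symmetric] using z by auto
qed

text \<open>The parity of the diameter decides \<open>z\<close>, as the middle of a longest path is
  a vertex or an edge.\<close>

lemma lwr_tree_level_regular:
  assumes "h \<ge> 1" "m 0 = 2" "\<forall>i \<in> {1..h-1}. m i \<ge> 3" "is_lwr_tree T z h m" "z = 1 \<or> z = 2"
  shows "level_regular_tree (verts T) (gdist T) (center T) h z m" "diameter T + 1 = 2 * h + z"
proof -
  have T: "undirected_tree T" "card (center T) = z" "height T = h"
      "\<And>i v. i < h \<Longrightarrow> v \<in> level T i \<Longrightarrow> out_degree T v = m i"
    using assms(4) by (auto simp: is_lwr_tree_def level_wise_regular_def)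
  interpret tree_metric "verts T" "gdist T" using gdist_tree_metric[OF T(1)] .
  have diam: "diam = diameter T" unfolding diam_def diameter_def ..
  have centre: "centre = center T" unfolding centre_def center_def ecc_def eccentricity_def ..
  have h: "h = diam div 2" using T(3) by (simp add: diam height_def)
  have sub: "center T \<subseteq> verts T" unfolding center_def by blast
  have fin_c: "finite (center T)" using sub fin finite_subset by blast
  have depth_le: "depth (center T) v \<le> gdist T c v" if "c \<in> center T" for c v
    unfolding depth_def using fin_c that by (intro Min_le) auto
  have "(\<forall>c\<in>center T. \<forall>c'\<in>center T. c \<noteq> c' \<longrightarrow> gdist T c c' = 1) \<and>
      (\<forall>v\<in>verts T. depth (center T) v \<le> h) \<and> diameter T + 1 = 2 * h + z"
  proof (cases "even diam")
    case True
    then obtain c where c: "center T = {c}" "\<forall>v\<in>verts T. gdist T c v \<le> h"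
      using centre_even unfolding centre h by blast
    then have "z = 1" using T(2) by simp
    moreover have "depth (center T) v \<le> h" if "v \<in> verts T" for v
      using depth_le[of c v] c that by force
    moreover have "diameter T = 2 * h" using True unfolding diam[symmetric] h by simp
    ultimately show ?thesis using c(1) by simp
  next
    case False
    then obtain c c' where c: "c \<in> center T" "c' \<in> center T" "gdist T c c' = 1"
        "\<forall>v\<in>verts T. min (gdist T c v) (gdist T c' v) \<le> h"
      using centre_odd unfolding centre h by blast
    have "c \<noteq> c'" using c sub by auto
    then have two: "card {c, c'} = 2" by simp
    then have "2 \<le> card (center T)" using c card_mono[OF fin_c, of "{c, c'}"] by simp
    \<comment> \<open>The assumption on \<open>z\<close> excludes a third central vertex, so the two
      found are the whole center.\<close>
    then have z2: "z = 2" using assms(5) T(2) by simp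
    have eq: "center T = {c, c'}" using c two z2 T(2) card_subset_eq[OF fin_c, of "{c, c'}"] by simp
    have "gdist T c' c = 1" using c sub d_sym[of c' c] by auto
    then have "\<forall>c\<in>center T. \<forall>c'\<in>center T. c \<noteq> c' \<longrightarrow> gdist T c c' = 1" using c(3) eq by auto
    moreover have "depth (center T) v \<le> h" if "v \<in> verts T" for v
      using depth_le[OF c(1), of v] depth_le[OF c(2), of v] c(4) that by force
    moreover have "diameter T = 2 * h + 1" using False odd_two_times_div_two_succ[of diam]
      unfolding diam[symmetric] h by simp
    ultimately show ?thesis using z2 by simp
  qed
  note facts = this
  show "diameter T + 1 = 2 * h + z" using facts by blast
  show "level_regular_tree (verts T) (gdist T) (center T) h z m"
  proof
    show "card {w \<in> verts T. gdist T v w = 1} = m (depth (center T) v)"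
      if "v \<in> verts T" "depth (center T) v < h" for v
    proof -
      have "v \<in> level T (depth (center T) v)" using that unfolding level_def depth_def by simp
      then show ?thesis using T(4)[OF that(2)] out_degree_gdist[OF T(1) that(1)] by simp
    qed
  qed (use facts assms sub T(2) in auto)
qed

theorem theorem4p1:
  fixes T :: "('a, 'b) pre_digraph" and z h :: nat and m :: "nat \<Rightarrow> nat"
  assumes "h \<ge> 1"
    and "z = 1 \<or> z = 2"
    and "z = 1 \<longrightarrow> h \<ge> 2"
    and "m 0 = 2"
    and "\<forall>i \<in> {1..h-1}. m i \<ge> 3"
    and "is_lwr_tree T z h m"
  shows "int (radio_number T) =
    (if z = 1
     then (\<Sum>i = 1..h-1. (4 * (int h - int i) - 2) * (\<Prod>j = 1..i. (int (m j) - 1)))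
            + (\<Prod>i = 1..h-1. (int (m i) - 1)) + 4 * int h - 1
     else (\<Sum>i = 1..h-1. (4 * (int h - int i) - 2) * (\<Prod>j = 1..i. (int (m j) - 1)))
            + 2 * (\<Prod>i = 1..h-1. (int (m i) - 1)) + 6 * int h - 3)"
proof -
  interpret level_regular_tree "verts T" "gdist T" "center T" h z m
    using lwr_tree_level_regular(1)[OF assms(1,4,5,6,2)] .
  have "int (diameter T) + 1 = 2 * int h + int z"
    using lwr_tree_level_regular(2)[OF assms(1,4,5,6,2)] by linarith
  then have radio_iff: "radio_labelling T f \<longleftrightarrow> radio f" for f
    unfolding radio_labelling_def radio_def by simp
  have pairs: "{nat \<bar>int (f u) - int (f v)\<bar> | u v. u \<in> verts T \<and> v \<in> verts T} =
      (\<lambda>(u, v). nat \<bar>int (f u) - int (f v)\<bar>) ` (verts T \<times> verts T)" for f :: "'a \<Rightarrow> nat"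
    by auto
  have span_ge: "\<bar>int (f u) - int (f v)\<bar> \<le> int (radio_span T f)"
    if "u \<in> verts T" "v \<in> verts T" for f u v
  proof -
    have "nat \<bar>int (f u) - int (f v)\<bar> \<le> radio_span T f"
      unfolding radio_span_def pairs using fin that by (intro Max_ge) auto
    then show ?thesis by simp
  qed
  obtain f where f: "radio f" "\<forall>v\<in>verts T. int (f v) \<le> opt_span" using span_upper by blast
  have "int (radio_span T f) \<le> opt_span"
  proof -
    have "radio_span T f \<in> (\<lambda>(u, v). nat \<bar>int (f u) - int (f v)\<bar>) ` (verts T \<times> verts T)"
      unfolding radio_span_def pairs using fin ne by (intro Max_in) auto
    then obtain u v where "u \<in> verts T" "v \<in> verts T" "radio_span T f = nat \<bar>int (f u) - int (f v)\<bar>"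
      by auto
    moreover from this have "int (f u) \<le> opt_span" "int (f v) \<le> opt_span" using f(2) by blast+
    ultimately show ?thesis by simp
  qed
  moreover have "radio_number T \<le> radio_span T f"
    unfolding radio_number_def using f(1) radio_iff by (intro Least_le) blast
  moreover have "opt_span \<le> int (radio_number T)"
  proof -
    have "\<exists>k f. radio_labelling T f \<and> radio_span T f = k" using f(1) radio_iff by blast
    from LeastI_ex[OF this] obtain f' where "radio f'" "radio_span T f' = radio_number T"
      unfolding radio_number_def radio_iff by blast
    then show ?thesis using span_lower[of f'] span_ge assms(3) by (metis order_trans)
  qed
  ultimately have "int (radio_number T) = opt_span" by linarith
  then show ?thesis unfolding opt_span_eq .
qed

end
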